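(* Let $\mathcal V$ and $\mathcal W$ be two vector spaces of $n\times n$ matrices over $\mathbb F$. (a) Let $\mathbb F$ be an algebraically closed field of characteristic different from $2$. Let the matrices of $\mathcal V$ and $\mathcal W$ be all symmetric or all skew-symmetric. Then $\mathcal V$ and $\mathcal W$ are equivalent if and only if they are congruent. (b) Let $\mathbb F$ be a real closed field. Let the matrices of $\mathcal V$ and $\mathcal W$ be all symmetric or all skew-symmetric. Then $\mathcal V$ and $\mathcal W$ are equivalent if and only if there exist $p\in\{0,1,\dots,n\}$ and a space $\mathcal U$ of $(p,n-p)$ block diagonal matrices over $\mathbb F$ such that $\mathcal V$ is congruent to $\mathcal U$ and $(I_p\oplus -I_{n-p})\,\mathcal U$ is congruent to $\mathcal W$. (c) Let $\mathbb F$ be an algebraically closed field with a fixed nonidentity involution. Let all matrices of $\mathcal V$ and $\mathcal W$ be Hermitian. Then $\mathcal V$ and $\mathcal W$ are equivalent if and only if there exist $p\in\{0,1,\dots,n\}$ and a space $\mathcal U$ of $(p,n-p)$ block diagonal Hermitian matrices over $\mathbb F$ such that $\mathcal V$ is *congruent to $\mathcal U$ and $(I_p\oplus -I_{n-p})\,\mathcal U$ is *congruent to $\mathcal W$.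
   Context: An involution on a field $\mathbb F$ is a bijection $a\mapsto\bar a$ of $\mathbb F$ such that $\overline{a+b}=\bar a+\bar b$, $\overline{ab}=\bar b\,\bar a$ and $\bar{\bar a}=a$ for all $a,b\in\mathbb F$. For a matrix $A$ over $\mathbb F$, $A^*:=\bar A^T$; $A$ is Hermitian if $A=A^*$. Two matrix vector spaces $\mathcal V,\mathcal W\subset\mathbb F^{n\times n}$ over $\mathbb F$ are: equivalent if $S\mathcal V R=\mathcal W$ for some nonsingular $S,R\in\mathbb F^{n\times n}$; congruent if $S\mathcal V S^T=\mathcal W$ for some nonsingular $S$; *congruent (with respect to the fixed involution) if $S\mathcal V S^*=\mathcal W$ for some nonsingular $S$. Here $S\mathcal V R:=\{SAR: A\in\mathcal V\}$, and similarly $S\mathcal V:=\{SA:A\in\mathcal V\}$. For $p,q\in\{0,1,2,\dots\}$, a $(p,q)$ block diagonal matrix is a matrix of the form $\begin{bmatrix}A&0\\0&B\end{bmatrix}$ with $A$ of size $p\times p$ and $B$ of size $q\times q$. $I_p\oplus -I_{n-p}$ denotes the block diagonal matrix with diagonal blocks $I_p$ and $-I_{n-p}$. A real closed field is a field whose algebraic closure is two-dimensional over it. *)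

theory Defs
  imports
    "Jordan_Normal_Form.VS_Connect"
    "HOL-Algebra.Algebraic_Closure_Type"
begin

section \<open>Fields\<close>

definition field_involution :: "('a::field \<Rightarrow> 'a) \<Rightarrow> bool" where
  "field_involution \<sigma> \<longleftrightarrow>
     bij \<sigma> \<and>
     (\<forall>a b. \<sigma> (a + b) = \<sigma> a + \<sigma> b) \<and>
     (\<forall>a b. \<sigma> (a * b) = \<sigma> b * \<sigma> a) \<and>
     (\<forall>a. \<sigma> (\<sigma> a) = a)"

abbreviation ac_scale :: "'a::field \<Rightarrow> 'a alg_closure \<Rightarrow> 'a alg_closure" where
  "ac_scale a x \<equiv> to_ac a * x"

lemma vector_space_ac_scale: "vector_space (ac_scale :: 'a::field \<Rightarrow> _)"
  by unfold_locales (simp_all add: algebra_simps)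

text \<open>The dimension of an infinite-dimensional space is \<open>0\<close> by convention,
  so dimension \<open>2\<close> really means that there is a basis with two elements.\<close>

definition real_closed :: "'a::field itself \<Rightarrow> bool" where
  "real_closed _ \<longleftrightarrow>
     vector_space.dim (ac_scale :: 'a \<Rightarrow> _) (UNIV :: 'a alg_closure set) = 2"


section \<open>Matrices\<close>

definition symmetric_mat :: "'a mat \<Rightarrow> bool" where
  "symmetric_mat A \<longleftrightarrow> transpose_mat A = A"

definition skew_symmetric_mat :: "'a::uminus mat \<Rightarrow> bool" where
  "skew_symmetric_mat A \<longleftrightarrow> transpose_mat A = - A"

definition star_mat :: "('a \<Rightarrow> 'a) \<Rightarrow> 'a mat \<Rightarrow> 'a mat" where
  "star_mat \<sigma> A = transpose_mat (map_mat \<sigma> A)"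

definition hermitian_mat :: "('a \<Rightarrow> 'a) \<Rightarrow> 'a mat \<Rightarrow> bool" where
  "hermitian_mat \<sigma> A \<longleftrightarrow> star_mat \<sigma> A = A"

definition block_diagonal :: "nat \<Rightarrow> nat \<Rightarrow> 'a::zero mat \<Rightarrow> bool" where
  "block_diagonal p q M \<longleftrightarrow>
     (\<exists>A\<in>carrier_mat p p. \<exists>B\<in>carrier_mat q q.
        M = four_block_mat A (0\<^sub>m p q) (0\<^sub>m q p) B)"

definition sign_mat :: "nat \<Rightarrow> nat \<Rightarrow> 'a::ring_1 mat" where
  "sign_mat p q = four_block_mat (1\<^sub>m p) (0\<^sub>m p q) (0\<^sub>m q p) (- 1\<^sub>m q)"


section \<open>Spaces of matrices\<close>

text \<open>\<open>K\<close> is the field of scalars: either all of \<open>'a\<close>, or a subfield, in which case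
  the spaces need not be closed under multiplication by elements of \<open>'a\<close> outside \<open>K\<close>.\<close>

definition mat_space_over :: "'a::field set \<Rightarrow> nat \<Rightarrow> 'a mat set \<Rightarrow> bool" where
  "mat_space_over K n V \<longleftrightarrow>
     VectorSpace.subspace (class_ring\<lparr>carrier := K\<rparr>) V (module_mat TYPE('a) n n)"

abbreviation mat_space :: "nat \<Rightarrow> 'a::field mat set \<Rightarrow> bool" where
  "mat_space \<equiv> mat_space_over UNIV"

definition equivalent_spaces :: "nat \<Rightarrow> 'a::field mat set \<Rightarrow> 'a mat set \<Rightarrow> bool" where
  "equivalent_spaces n V W \<longleftrightarrow>
     (\<exists>S\<in>carrier_mat n n. \<exists>R\<in>carrier_mat n n.
        invertible_mat S \<and> invertible_mat R \<and> (\<lambda>A. S * A * R) ` V = W)"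

definition congruent_spaces :: "nat \<Rightarrow> 'a::field mat set \<Rightarrow> 'a mat set \<Rightarrow> bool" where
  "congruent_spaces n V W \<longleftrightarrow>
     (\<exists>S\<in>carrier_mat n n. invertible_mat S \<and> (\<lambda>A. S * A * transpose_mat S) ` V = W)"

definition star_congruent_spaces ::
  "('a::field \<Rightarrow> 'a) \<Rightarrow> nat \<Rightarrow> 'a mat set \<Rightarrow> 'a mat set \<Rightarrow> bool" where
  "star_congruent_spaces \<sigma> n V W \<longleftrightarrow>
     (\<exists>S\<in>carrier_mat n n. invertible_mat S \<and> (\<lambda>A. S * A * star_mat \<sigma> S) ` V = W)"

text \<open>If \<open>\<sigma>\<close> is not the identity, the only space of Hermitian matrices over all of \<open>'a\<close> is
  \<open>{0}\<close>, and Hermitian matrices form a space only over the fixed field of \<open>\<sigma>\<close>.  Both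
  fields are therefore admitted as scalars for spaces of Hermitian matrices.\<close>

definition hermitian_scalars :: "('a::field \<Rightarrow> 'a) \<Rightarrow> 'a set set" where
  "hermitian_scalars \<sigma> = {UNIV, {a. \<sigma> a = a}}"

lemma field_restricted_scalars:
  fixes K :: "'a::field set"
  assumes "0 \<in> K" "1 \<in> K"
    and "\<And>a b. a \<in> K \<Longrightarrow> b \<in> K \<Longrightarrow> a + b \<in> K"
    and "\<And>a b. a \<in> K \<Longrightarrow> b \<in> K \<Longrightarrow> a * b \<in> K"
    and "\<And>a. a \<in> K \<Longrightarrow> - a \<in> K"
    and "\<And>a. a \<in> K \<Longrightarrow> inverse a \<in> K"
  shows "Ring.field (class_ring\<lparr>carrier := K\<rparr>)"
proof (rule cring.cring_fieldI2)
  show "cring (class_ring\<lparr>carrier := K\<rparr>)"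
  proof (rule cringI)
    show "abelian_group (class_ring\<lparr>carrier := K\<rparr>)"
      by (rule abelian_groupI) (use assms in \<open>auto simp: algebra_simps intro!: bexI[of _ "- x" for x]\<close>)
    show "Group.comm_monoid (class_ring\<lparr>carrier := K\<rparr>)"
      by (rule comm_monoidI) (use assms in \<open>auto simp: algebra_simps\<close>)
  qed (simp add: algebra_simps)
next
  fix a assume "a \<in> carrier (class_ring\<lparr>carrier := K\<rparr>)" "a \<noteq> \<zero>\<^bsub>class_ring\<lparr>carrier := K\<rparr>\<^esub>"
  then show "\<exists>b\<in>carrier (class_ring\<lparr>carrier := K\<rparr>).
      a \<otimes>\<^bsub>class_ring\<lparr>carrier := K\<rparr>\<^esub> b = \<one>\<^bsub>class_ring\<lparr>carrier := K\<rparr>\<^esub>"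
    using assms(6) by (auto intro!: bexI[of _ "inverse a"])
qed simp

lemma mat_space_over_iff:
  fixes \<sigma> :: "'a::field \<Rightarrow> 'a"
  assumes K: "K = UNIV \<or> field_involution \<sigma> \<and> K = {a. \<sigma> a = a}"
  shows "mat_space_over K n V \<longleftrightarrow>
    V \<subseteq> carrier_mat n n \<and> 0\<^sub>m n n \<in> V \<and>
    (\<forall>A\<in>V. \<forall>B\<in>V. A + B \<in> V) \<and> (\<forall>c\<in>K. \<forall>A\<in>V. c \<cdot>\<^sub>m A \<in> V)"
proof -
  have inj: "a = b" if "field_involution \<sigma>" "\<sigma> a = \<sigma> b" for a b
    using that unfolding field_involution_def by metis
  have z: "\<sigma> 0 = 0" if "field_involution \<sigma>"
  proof -
    have "\<sigma> (0 + 0) = \<sigma> 0 + \<sigma> 0" using that unfolding field_involution_def by blast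
    then show ?thesis by (metis add.right_neutral add_left_cancel)
  qed
  have o: "\<sigma> 1 = 1" if "field_involution \<sigma>"
  proof -
    have "\<sigma> (1 * 1) = \<sigma> 1 * \<sigma> 1" using that unfolding field_involution_def by blast
    moreover have "\<sigma> 1 \<noteq> 0" using inj[OF that, of 1 0] z[OF that] by auto
    ultimately show ?thesis by simp
  qed
  have neg: "\<sigma> (- a) = - \<sigma> a" if "field_involution \<sigma>" for a
  proof -
    have "\<sigma> (a + - a) = \<sigma> a + \<sigma> (- a)" using that unfolding field_involution_def by blast
    then show ?thesis using z[OF that] by (simp add: minus_unique)
  qed
  have inv: "\<sigma> (inverse a) = inverse (\<sigma> a)" if "field_involution \<sigma>" for a
  proof (cases "a = 0")
    case False
    have "\<sigma> (inverse a * a) = \<sigma> a * \<sigma> (inverse a)"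
      using that unfolding field_involution_def by blast
    then have "\<sigma> a * \<sigma> (inverse a) = 1" using False o[OF that] by simp
    then show ?thesis by (rule inverse_unique[symmetric])
  qed (simp add: z[OF that])
  have fld: "Ring.field (class_ring\<lparr>carrier := K\<rparr>)"
    by (rule field_restricted_scalars)
      (use K in \<open>auto simp: z o neg inv field_involution_def mult.commute\<close>)
  have mod: "Module.module (class_ring\<lparr>carrier := K\<rparr>) (module_mat TYPE('a) n n)"
    by (rule Module.moduleI[OF _ abelian_group_mat])
      (use fld in \<open>auto simp: module_mat_def Ring.field_def domain_def
          add_smult_distrib_right_mat add_smult_distrib_left_mat\<close>)
  show ?thesis
    unfolding mat_space_over_def VectorSpace.subspace_def vectorspace_def
      LinearCombinations.submodule_def
    using fld mod by (auto simp: module_mat_def)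
qed

end

theory Submission
  imports Defs "Jordan_Normal_Form.DL_Rank" "Jordan_Normal_Form.Schur_Decomposition"
begin

text \<open>
  Let \<open>\<tau>\<close> be an involution of the field, the identity in the symmetric and skew-symmetric
  cases, and write \<open>A\<^sup>*\<close> for the conjugate transpose. The matrices of both spaces satisfy
  \<open>A\<^sup>* = e A\<close> with one nonzero scalar \<open>e\<close>. If \<open>W = S V R\<close>, then replacing \<open>V\<close> by its
  congruent copy \<open>S V S\<^sup>*\<close> leaves \<open>W = V P\<close> for a nonsingular \<open>P\<close>, and comparing \<open>A P\<close> with
  its own conjugate transpose gives \<open>A P = P\<^sup>* A\<close> for all \<open>A\<close> in \<open>V\<close>
  (\<open>equivalence_reduction\<close>). Hence \<open>A f(P) = f(P)\<^sup>* A\<close> for every polynomial \<open>f\<close> with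
  coefficients fixed by \<open>\<tau>\<close>.

  Over an algebraically closed field of characteristic not \<open>2\<close>, \<open>P = G\<^sup>2\<close> for some polynomial
  \<open>G = g(P)\<close>, so that \<open>A P = A G G = G\<^sup>* A G\<close> is a congruence. Over a real closed field, and
  likewise over the fixed field of a nonidentity involution, negative eigenvalues obstruct the
  square root, but \<open>P\<^sup>2\<close> still has a fourth root \<open>G = g(P)\<close>: either \<open>x\<close> or \<open>-x\<close> is a square,
  so \<open>x\<^sup>2\<close> is a fourth power. Then \<open>D = G\<^sup>2 P\<^sup>-\<^sup>1\<close> satisfies \<open>D\<^sup>2 = 1\<close>, \<open>A D = D\<^sup>* A\<close> and
  \<open>A P = G\<^sup>* (A D) G\<close>. Diagonalising \<open>D = T J T\<^sup>-\<^sup>1\<close> with \<open>J = I\<^sub>p \<oplus> -I\<^sub>q\<close>, the relation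
  \<open>A D = D\<^sup>* A\<close> says that \<open>T\<^sup>* A T\<close> commutes with \<open>J\<close>, that is, it is block diagonal; these
  matrices form the space \<open>U\<close>, and \<open>J U\<close> is congruent to \<open>W\<close>
  (\<open>signed_congruence_of_equivalent\<close>). The converse directions only compose the given
  transformations.

  The polynomial \<open>g\<close> is found modulo a product \<open>M\<close> of linear factors annihilating \<open>P\<close>: prescribed
  nonzero root values at the zeros of \<open>M\<close> lift to a root modulo \<open>M\<close> (\<open>root_lifting\<close>), uniquely
  (\<open>root_lifting_unique\<close>). If \<open>M\<close> and the prescribed values are compatible with \<open>\<sigma>\<close>, uniqueness
  makes the lift invariant under \<open>\<sigma>\<close>, which is how coefficients in the fixed field are obtained.
  A real closed field is treated as the fixed field of an involution of its algebraic closure.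
\<close>

section \<open>Roots of polynomials modulo products of linear factors\<close>

text \<open>
  The linear Taylor expansion of a power, with a remainder divisible by \<open>e\<^sup>2\<close>; it drives the
  lifting step in \<open>root_lifting\<close>.
\<close>

lemma power_add_expand:
  fixes g e :: "'a::comm_ring_1"
  shows "\<exists>w. (g + e) ^ k = g ^ k + of_nat k * g ^ (k - 1) * e + e ^ 2 * w"
proof (induction k)
  case 0
  then show ?case by (intro exI[of _ 0]) simp
next
  case (Suc k)
  then obtain w where w: "(g + e) ^ k = g ^ k + of_nat k * g ^ (k - 1) * e + e ^ 2 * w" by blast
  have "(g + e) ^ Suc k = g ^ Suc k + of_nat (Suc k) * g ^ k * e
      + e ^ 2 * (of_nat k * g ^ (k - 1) + (g + e) * w)"
    unfolding power_Suc w by (cases k) (simp_all add: algebra_simps power2_eq_square)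
  then show ?case by auto
qed

text \<open>
  Hensel lifting and the Chinese remainder theorem in one induction. To pass from \<open>M\<close> to
  \<open>(X - x) M\<close>, correct the root \<open>g\<close> by a constant multiple \<open>t M\<close>. If \<open>x\<close> is already a zero of
  \<open>M\<close>, then \<open>t\<close> enters the condition at \<open>x\<close> linearly with coefficient \<open>k c(x)\<^sup>k\<^sup>-\<^sup>1 \<noteq> 0\<close>;
  otherwise \<open>t\<close> is chosen by interpolation.
\<close>

lemma root_lifting:
  fixes l :: "'a::field list"
  assumes k: "of_nat k \<noteq> (0::'a)"
    and c: "\<And>x. x \<in> set l \<Longrightarrow> c x \<noteq> 0 \<and> c x ^ k = poly a x"
  shows "\<exists>g. (\<Prod>x\<leftarrow>l. [:- x, 1:]) dvd g ^ k - a \<and> (\<forall>x\<in>set l. poly g x = c x)"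
  using c
proof (induction l)
  case Nil
  then show ?case by simp
next
  case (Cons x l)
  define M where "M = (\<Prod>x\<leftarrow>l. [:- x, 1:])"
  obtain g h where h: "g ^ k - a = M * h" and g: "\<forall>y\<in>set l. poly g y = c y"
    using Cons unfolding M_def by (auto elim!: dvdE)
  have M0: "poly M y = 0 \<longleftrightarrow> y \<in> set l" for y
    unfolding M_def by (induction l) auto
  have cx: "c x \<noteq> 0" "c x ^ k = poly a x" using Cons.prems by auto
  define t where "t = (if x \<in> set l then - poly h x / (of_nat k * c x ^ (k - 1))
    else (c x - poly g x) / poly M x)"
  define f where "f = g + smult t M"
  obtain w where w: "f ^ k = g ^ k + of_nat k * g ^ (k - 1) * smult t M + (smult t M) ^ 2 * w"
    unfolding f_def using power_add_expand by blast
  (* M * N is the new error, so it remains to see that N vanishes at x. *)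
  define N where "N = h + of_nat k * g ^ (k - 1) * [:t:] + [:t:] * smult t M * w"
  have fN: "f ^ k - a = M * N"
  proof -
    have "f ^ k - a = (g ^ k - a) + of_nat k * g ^ (k - 1) * smult t M + (smult t M) ^ 2 * w"
      unfolding w by simp
    also have "\<dots> = M * N"
      unfolding h N_def by (simp add: algebra_simps power2_eq_square)
    finally show ?thesis .
  qed
  have fx: "poly f x = c x"
    using g M0[of x] by (cases "x \<in> set l") (auto simp: f_def t_def)
  have "poly N x = 0"
  proof (cases "x \<in> set l")
    case True
    then show ?thesis
      using g M0[of x] cx k by (simp add: N_def t_def field_simps)
  next
    case False
    have "poly (M * N) x = 0" using fx cx fN by (metis cancel_comm_monoid_add_class.diff_cancel poly_diff poly_power)
    then show ?thesis using False M0[of x] by simp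
  qed
  then have "[:- x, 1:] dvd N" by (simp add: poly_eq_0_iff_dvd)
  then have "[:- x, 1:] * M dvd f ^ k - a"
    unfolding fN by (metis dvd_refl mult.commute mult_dvd_mono)
  moreover have "\<forall>y\<in>set (x # l). poly f y = c y"
    using fx g M0 by (auto simp: f_def)
  ultimately show ?case unfolding M_def by (intro exI[of _ f]) auto
qed

lemma linear_factors_dvd_cancel:
  fixes l :: "'a::field list"
  assumes "(\<Prod>x\<leftarrow>l. [:- x, 1:]) dvd u * v" and "\<And>x. x \<in> set l \<Longrightarrow> poly v x \<noteq> 0"
  shows "(\<Prod>x\<leftarrow>l. [:- x, 1:]) dvd u"
  using assms
proof (induction l)
  case (Cons x l)
  define M where "M = (\<Prod>x\<leftarrow>l. [:- x, 1:])"
  have M: "M \<noteq> 0" unfolding M_def by (auto simp: prod_list_zero_iff)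
  have "[:- x, 1:] * M dvd u * v" using Cons.prems(1) unfolding M_def by (simp only: list.map prod_list.Cons)
  then have "M dvd u * v" by (rule dvd_mult_right)
  then obtain w where w: "u = M * w" using Cons unfolding M_def by (auto elim!: dvdE)
  obtain z where "u * v = [:- x, 1:] * M * z" using Cons.prems(1) unfolding M_def by (auto elim!: dvdE)
  then have "M * (w * v) = M * ([:- x, 1:] * z)" unfolding w by (simp only: ac_simps)
  then have "w * v = [:- x, 1:] * z" using M by (simp only: mult_cancel_left) simp
  then have "poly (w * v) x = 0" by simp
  then have "poly w x = 0" using Cons.prems(2) by simp
  then have "[:- x, 1:] dvd w" by (simp add: poly_eq_0_iff_dvd)
  then have "[:- x, 1:] * M dvd u" unfolding w by (metis dvd_refl mult.commute mult_dvd_mono)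
  then show ?case unfolding M_def by simp
qed simp

text \<open>
  The cofactor of \<open>g - f\<close> in \<open>g\<^sup>k - f\<^sup>k\<close> takes the value \<open>k g(x)\<^sup>k\<^sup>-\<^sup>1 \<noteq> 0\<close> at each zero \<open>x\<close>
  of the modulus, so it is coprime to it.
\<close>

lemma root_lifting_unique:
  fixes l :: "'a::field list"
  assumes k: "of_nat k \<noteq> (0::'a)"
    and dvd: "(\<Prod>x\<leftarrow>l. [:- x, 1:]) dvd g ^ k - f ^ k"
    and c: "\<And>x. x \<in> set l \<Longrightarrow> poly f x = poly g x \<and> poly g x \<noteq> 0"
  shows "(\<Prod>x\<leftarrow>l. [:- x, 1:]) dvd g - f"
proof (rule linear_factors_dvd_cancel)
  show "(\<Prod>x\<leftarrow>l. [:- x, 1:]) dvd (g - f) * (\<Sum>i<k. f ^ (k - Suc i) * g ^ i)"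
    using dvd by (simp add: power_diff_sumr2)
  show "poly (\<Sum>i<k. f ^ (k - Suc i) * g ^ i) x \<noteq> 0" if "x \<in> set l" for x
  proof -
    have "poly (\<Sum>i<k. f ^ (k - Suc i) * g ^ i) x = (\<Sum>i<k. poly g x ^ (k - 1))"
      using c[OF that] by (auto simp: poly_sum power_add[symmetric] intro!: sum.cong)
    then show ?thesis using k c[OF that] by simp
  qed
qed

section \<open>Involutions of algebraically closed fields\<close>

lemma field_involution_hom:
  assumes "field_involution \<sigma>"
  shows "inj_comm_ring_hom \<sigma>"
proof -
  have add: "\<sigma> (a + b) = \<sigma> a + \<sigma> b" and mult: "\<sigma> (a * b) = \<sigma> a * \<sigma> b"
    and inv: "\<sigma> (\<sigma> a) = a" for a b
    using assms unfolding field_involution_def by (auto simp: mult.commute)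
  have 0: "\<sigma> 0 = 0" using add[of 0 0] by (metis add.right_neutral add_left_cancel)
  have "\<sigma> 1 \<noteq> 0" using inv[of 1] 0 by auto
  then have 1: "\<sigma> 1 = 1" using mult[of 1 1] by simp
  show ?thesis
    by unfold_locales (use add mult 0 1 in auto, metis 0 inv)
qed

lemma field_involution_id: "field_involution (id :: 'a::field \<Rightarrow> 'a)"
  unfolding field_involution_def by (simp add: mult.commute)

context
  fixes \<sigma> :: "'a::alg_closed_field \<Rightarrow> 'a"
  assumes inv: "field_involution \<sigma>" and nonid: "\<sigma> \<noteq> id"
begin

interpretation inj_comm_ring_hom \<sigma> by (rule field_involution_hom[OF inv])

lemma involution_involutive: "\<sigma> (\<sigma> x) = x"
  using inv unfolding field_involution_def by blast

text \<open>
  Artin--Schreier: in characteristic \<open>2\<close> some \<open>y\<close> has \<open>\<sigma> y = y + 1\<close>. For a root \<open>u\<close> of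
  \<open>u\<^sup>2 + u = y \<sigma>(y) y\<close> the trace \<open>w = u + \<sigma> u\<close> satisfies \<open>w\<^sup>2 + w = y \<sigma>(y) = y\<^sup>2 + y\<close>, hence
  \<open>w\<close> is \<open>y\<close> or \<open>y + 1\<close>; but \<open>w\<close> is fixed by \<open>\<sigma>\<close> and these are not.
\<close>

lemma two_nonzero_of_involution: "(2::'a) \<noteq> 0"
proof
  assume two: "(2::'a) = 0"
  (* In characteristic 2 signs disappear and doubled terms cancel. *)
  have dbl: "x + x = 0" for x :: 'a using two by (metis mult_2 mult_zero_left)
  have neg: "- x = x" for x :: 'a using dbl[of x] by (simp add: neg_eq_iff_add_eq_0)
  obtain z where z: "\<sigma> z \<noteq> z" using nonid by (auto simp: fun_eq_iff)
  define t where "t = z + \<sigma> z"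
  have t0: "t \<noteq> 0" using z neg[of z] unfolding t_def by (metis add_eq_0_iff)
  have t: "\<sigma> t = t" unfolding t_def by (simp add: hom_add involution_involutive add.commute)
  define y where "y = z / t"
  have yt: "y * t = z" using t0 by (simp add: y_def)
  have "\<sigma> y * t = \<sigma> z" using hom_mult[of y t] yt t by simp
  also have "\<sigma> z = (y + 1) * t" using yt dbl[of z] by (simp add: algebra_simps t_def)
  finally have y: "\<sigma> y = y + 1" using t0 by simp
  obtain u where "poly [:- (y * \<sigma> y * y), 1, 1:] u = 0"
    using alg_closed_imp_poly_has_root[of "[:- (y * \<sigma> y * y), 1, 1:]"] by auto
  then have u: "u * u + u = y * \<sigma> y * y" by (simp add: algebra_simps)
  define w where "w = u + \<sigma> u"
  have "\<sigma> (u * u + u) = y * \<sigma> y * \<sigma> y" unfolding u by (simp add: hom_mult involution_involutive)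
  then have su: "\<sigma> u * \<sigma> u + \<sigma> u = y * \<sigma> y * \<sigma> y" by (simp add: hom_distribs)
  have "w * w + w = (u * u + u) + (\<sigma> u * \<sigma> u + \<sigma> u) + (u * \<sigma> u + u * \<sigma> u)"
    unfolding w_def by (simp add: algebra_simps)
  also have "\<dots> = y * \<sigma> y * (y + \<sigma> y)" unfolding u su dbl by (simp add: algebra_simps)
  also have "\<dots> = y * (y + 1) * (1 + (y + y))" unfolding y by (simp add: algebra_simps)
  also have "\<dots> = y * y + y" unfolding dbl by (simp add: algebra_simps)
  finally have "(w + y) * (w + (y + 1)) = (y * y + y) + (y * y + y) + (w * y + w * y)"
    by (simp add: algebra_simps)
  then have "(w + y) * (w + (y + 1)) = 0" unfolding dbl by simp
  then have "w = y \<or> w = y + 1" using neg by (metis add_eq_0_iff mult_eq_0_iff)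
  moreover have "\<sigma> w = w" unfolding w_def by (simp add: hom_add involution_involutive add.commute)
  moreover have "\<sigma> (y + 1) = y" using y involution_involutive by metis
  ultimately show False using y by auto
qed

text \<open>
  Take \<open>w \<noteq> 0\<close> with \<open>\<sigma> w = -w\<close> and \<open>t\<^sup>2 = w\<close>. Then \<open>\<sigma> t = \<plusminus>i t\<close>, and if \<open>i\<close> were fixed, applying
  \<open>\<sigma>\<close> twice would give \<open>t = -t\<close>.
\<close>

lemma involution_imaginary_unit:
  assumes i: "i * i = - 1"
  shows "\<sigma> i = - i"
proof (rule ccontr)
  assume ne: "\<sigma> i \<noteq> - i"
  have "\<sigma> i * \<sigma> i = i * i" using hom_mult[of i i] i by (simp add: hom_distribs)
  then have si: "\<sigma> i = i" using ne by (metis square_eq_iff)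
  obtain y where y: "\<sigma> y \<noteq> y" using nonid by (auto simp: fun_eq_iff)
  define w where "w = y - \<sigma> y"
  have w: "\<sigma> w = - w" "w \<noteq> 0" using y unfolding w_def by (auto simp: hom_distribs involution_involutive)
  obtain t where "poly [:- w, 0, 1:] t = 0"
    using alg_closed_imp_poly_has_root[of "[:- w, 0, 1:]"] by auto
  then have t: "t * t = w" by simp
  have "\<sigma> t * \<sigma> t = (i * t) * (i * t)" 
  proof -
    have "\<sigma> t * \<sigma> t = - (t * t)" using w(1) t by (simp add: hom_mult[symmetric])
    also have "\<dots> = (i * i) * (t * t)" using i by simp
    finally show ?thesis by (simp only: ac_simps)
  qed
  then have st: "\<sigma> t = i * t \<or> \<sigma> t = - (i * t)" by (metis square_eq_iff)
  have "\<sigma> (\<sigma> t) = - t"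
    using st
  proof
    assume "\<sigma> t = i * t"
    then show ?thesis using si i by (simp add: hom_mult) (simp add: mult.assoc[symmetric])
  next
    assume "\<sigma> t = - (i * t)"
    then show ?thesis using si i by (simp add: hom_distribs) (simp add: mult.assoc[symmetric])
  qed
  then have "2 * t = 0" by (metis involution_involutive mult_2 add.right_inverse)
  then show False using two_nonzero_of_involution w(2) t by auto
qed

text \<open>
  A fixed element \<open>x = s\<^sup>2\<close> has \<open>\<sigma> s = \<plusminus>s\<close>, and then \<open>s\<close> or \<open>i s\<close> is a fixed fourth root of
  \<open>x\<^sup>2\<close>. On an orbit with two elements, choose a root at one of them and transport it to the other.
\<close>

lemma equivariant_fourth_root:
  "\<exists>c. \<forall>x. c x ^ 4 = x ^ 2 \<and> c (\<sigma> x) = \<sigma> (c x)"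
proof -
  obtain i :: 'a where "poly [:1, 0, 1:] i = 0"
    using alg_closed_imp_poly_has_root[of "[:1::'a, 0, 1:]"] by auto
  then have ii: "i * i = - 1" by (simp add: add_eq_0_iff)
  have i: "\<sigma> i = - i" by (rule involution_imaginary_unit[OF ii])
  have ex: "\<exists>c. c ^ 4 = x ^ 2 \<and> (\<sigma> x = x \<longrightarrow> \<sigma> c = c)" for x
  proof -
    obtain s where "poly [:- x, 0, 1:] s = 0"
      using alg_closed_imp_poly_has_root[of "[:- x, 0, 1:]"] by auto
    then have s: "s * s = x" by simp
    have s4: "s ^ 4 = x ^ 2" unfolding s[symmetric] by (simp add: power4_eq_xxxx power2_eq_square)
    have is4: "(i * s) ^ 4 = x ^ 2"
    proof -
      have "(i * s) ^ 4 = (i * i) * (i * i) * s ^ 4" by (simp add: power4_eq_xxxx)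
      then show ?thesis using ii s4 by simp
    qed
    show ?thesis
    proof (cases "\<sigma> x = x")
      case True
      then have "\<sigma> s * \<sigma> s = s * s" using s hom_mult by metis
      then consider "\<sigma> s = s" | "\<sigma> s = - s" by (metis square_eq_iff)
      then show ?thesis
      proof cases
        case 1
        then show ?thesis using s4 by blast
      next
        case 2
        then have "\<sigma> (i * s) = i * s" using i by (simp add: hom_mult)
        then show ?thesis using is4 by blast
      qed
    qed (use s4 in blast)
  qed
  then obtain c where c: "c x ^ 4 = x ^ 2" and fixed: "\<sigma> x = x \<Longrightarrow> \<sigma> (c x) = c x" for x by metis
  (* r picks one representative of each orbit: it depends only on the set {x, \<sigma> x}. *)
  define r where "r x = (SOME y. y \<in> {x, \<sigma> x})" for x
  have r: "r x \<in> {x, \<sigma> x}" for x unfolding r_def by (rule someI[of _ x]) simp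
  have r\<sigma>: "r (\<sigma> x) = r x" for x
    unfolding r_def involution_involutive by (simp add: insert_commute)
  define d where "d x = (if x = r x then c x else \<sigma> (c (\<sigma> x)))" for x
  have "d x ^ 4 = x ^ 2" for x
  proof -
    have "\<sigma> (c (\<sigma> x)) ^ 4 = x ^ 2"
      using c[of "\<sigma> x"] by (metis hom_power involution_involutive)
    then show ?thesis unfolding d_def using c by simp
  qed
  moreover have "d (\<sigma> x) = \<sigma> (d x)" for x
  proof (cases "\<sigma> x = x")
    case True
    then show ?thesis using fixed[OF True] by (simp add: d_def)
  next
    case False
    then show ?thesis using r[of x] unfolding d_def r\<sigma> by (auto simp: involution_involutive)
  qed
  ultimately show ?thesis by blast
qed

text \<open>
  Work modulo the \<open>\<sigma>\<close>-invariant product \<open>M\<close> over \<open>l\<close> and its conjugates, with equivariant values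
  at the zeros. The conjugate of a lifted root is again a lifted root with the same values, so by
  uniqueness it agrees with the root modulo \<open>M\<close>, and so does their average, which is invariant.
\<close>

lemma invariant_poly_fourth_root:
  assumes l: "0 \<notin> set l"
  shows "\<exists>g. map_poly \<sigma> g = g \<and> (\<Prod>x\<leftarrow>l. [:- x, 1:]) dvd g ^ 4 - [:0, 1:] ^ 2"
proof -
  interpret P: map_poly_inj_comm_ring_hom \<sigma> ..
  obtain c where c: "\<And>x. c x ^ 4 = x ^ 2" "\<And>x. c (\<sigma> x) = \<sigma> (c x)"
    using equivariant_fourth_root by blast
  have four: "of_nat 4 \<noteq> (0::'a)"
  proof -
    have "(of_nat 4 :: 'a) = 2 * 2" by simp
    then show ?thesis using two_nonzero_of_involution by (metis mult_eq_0_iff)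
  qed
  let ?m = "l @ map \<sigma> l"
  define M where "M = (\<Prod>x\<leftarrow>?m. [:- x, 1:])"
  have nz: "x \<noteq> 0" "\<sigma> x \<in> set ?m" if "x \<in> set ?m" for x
    using that l by (auto simp: involution_involutive)
  have cnz: "c x \<noteq> 0" if "x \<in> set ?m" for x using c(1)[of x] nz(1)[OF that] by auto
  obtain g where g: "M dvd g ^ 4 - [:0, 1:] ^ 2" "\<And>x. x \<in> set ?m \<Longrightarrow> poly g x = c x"
    using root_lifting[OF four, of ?m c "[:0, 1:] ^ 2"] c(1) nz(1) unfolding M_def
    using cnz by auto
  define h where "h = map_poly \<sigma> g"
  have MM: "map_poly \<sigma> M = M"
  proof -
    have 1: "map_poly \<sigma> (\<Prod>x\<leftarrow>k. [:- x, 1:]) = (\<Prod>x\<leftarrow>map \<sigma> k. [:- x, 1:])" for k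
      by (induction k) (simp_all add: P.hom_mult hom_distribs)
    show ?thesis unfolding M_def 1 by (simp add: o_def involution_involutive mult.commute)
  qed
  have h: "M dvd h ^ 4 - [:0, 1:] ^ 2"
  proof -
    have "map_poly \<sigma> M dvd map_poly \<sigma> (g ^ 4 - [:0, 1:] ^ 2)" using g(1) by (rule P.hom_dvd)
    then show ?thesis unfolding MM h_def by (simp add: hom_distribs)
  qed
  have hx: "poly h x = c x" if "x \<in> set ?m" for x
  proof -
    have "poly h (\<sigma> (\<sigma> x)) = \<sigma> (poly g (\<sigma> x))" unfolding h_def by simp
    then show ?thesis using g(2)[OF nz(2)[OF that]] c(2) by (simp add: involution_involutive)
  qed
  have "M dvd g ^ 4 - h ^ 4" using dvd_diff[OF g(1) h] by simp
  then have gh: "M dvd g - h"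
    unfolding M_def by (rule root_lifting_unique[OF four]) (use g(2) hx cnz in auto)
  define f where "f = smult (1 / 2) (g + h)"
  have half: "\<sigma> (1 / 2) = 1 / 2"
  proof -
    have "\<sigma> (1 / 2) * 2 = \<sigma> (1 / 2 * 2)" by (simp only: hom_mult hom_numeral)
    then show ?thesis using two_nonzero_of_involution by (simp add: field_simps)
  qed
  have "map_poly \<sigma> h = g"
    unfolding h_def by (rule poly_eqI) (simp add: involution_involutive)
  then have "map_poly \<sigma> f = f"
    unfolding f_def by (simp add: hom_distribs half h_def add.commute)
  moreover have "M dvd f ^ 4 - [:0, 1:] ^ 2"
  proof -
    have "g - f = smult (1 / 2) (smult 2 g) - smult (1 / 2) (g + h)"
      unfolding f_def using two_nonzero_of_involution by simp
    also have "\<dots> = smult (1 / 2) (g - h)"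
    proof -
      have "smult 2 g = g + g" by (metis one_add_one smult_add_left smult_1_left)
      then show ?thesis by (simp only: smult_diff_right[symmetric]) simp
    qed
    finally have "M dvd g - f" using gh by (simp add: dvd_smult)
    then have "M dvd (g - f) * (\<Sum>i<4. f ^ (4 - Suc i) * g ^ i)" by (rule dvd_mult2)
    then have "M dvd g ^ 4 - f ^ 4" by (simp only: power_diff_sumr2)
    then have "M dvd (g ^ 4 - [:0, 1:] ^ 2) - (g ^ 4 - f ^ 4)" using g(1) by (rule dvd_diff[rotated])
    then show ?thesis by simp
  qed
  moreover have "(\<Prod>x\<leftarrow>l. [:- x, 1:]) dvd M" unfolding M_def by simp
  ultimately show ?thesis using dvd_trans by blast
qed

end

section \<open>Conjugation in the algebraic closure of a real closed field\<close>

text \<open>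
  A basis \<open>{e, f}\<close> of the algebraic closure can be exchanged for \<open>{1, e}\<close> or \<open>{1, f}\<close>.
\<close>

lemma quadratic_basis_of_real_closed:
  assumes "real_closed TYPE('b::field)"
  obtains x :: "'b::field alg_closure" where "x \<notin> range to_ac" "\<And>z. \<exists>u v. z = to_ac u + to_ac v * x"
proof -
  note basis = that
  interpret V: vector_space "ac_scale :: 'b \<Rightarrow> _" by (rule vector_space_ac_scale)
  obtain B :: "'b alg_closure set" where B: "\<not> V.dependent B" "V.span B = UNIV" "card B = 2"
  proof -
    have "V.dim (UNIV :: 'b alg_closure set) = 2" using assms unfolding real_closed_def .
    then obtain B :: "'b alg_closure set" where "\<not> V.dependent B \<and> V.span B = V.span UNIV" "card B = 2"
      unfolding V.dim_def by (metis (mono_tags, lifting) someI_ex zero_neq_numeral)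
    then show thesis using that[of B] by simp
  qed
  obtain e f where ef: "B = {e, f}" "e \<noteq> f" using B(3) by (auto simp: card_2_iff)
  have span: "\<exists>u v. z = to_ac u * e + to_ac v * f" for z
  proof -
    have "z \<in> V.span {e, f}" using B(2) ef(1) by simp
    then obtain u v where "z - to_ac u * e - to_ac v * f = 0"
      unfolding V.span_breakdown_eq V.span_empty by blast
    then have "z = to_ac u * e + to_ac v * f" by (simp add: algebra_simps)
    then show ?thesis by blast
  qed
  have indep: "u = 0 \<and> v = 0" if "to_ac u * e + to_ac v * f = 0" for u v
  proof (rule ccontr)
    assume "\<not> ?thesis"
    then have "\<exists>S r. finite S \<and> S \<subseteq> B \<and> (\<exists>w\<in>S. r w \<noteq> 0) \<and> (\<Sum>w\<in>S. ac_scale (r w) w) = 0"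
      using that ef
      by (intro exI[of _ "{e, f}"] exI[of _ "\<lambda>w. if w = e then u else v"]) auto
    then show False using B(1) unfolding V.dependent_explicit by blast
  qed
  have not_both: "\<not> (e \<in> range to_ac \<and> f \<in> range to_ac)"
  proof
    assume "e \<in> range to_ac \<and> f \<in> range to_ac"
    then obtain a b where ab: "e = to_ac a" "f = to_ac b" by auto
    have "to_ac b * e + to_ac (- a) * f = 0" unfolding ab by simp
    then have "b = 0 \<and> a = 0" using indep by fastforce
    then show False using ab ef(2) by simp
  qed
  have exchange: thesis if g: "\<And>z. \<exists>u v. z = to_ac u * g + to_ac v * h"
    and nb: "\<not> (g \<in> range to_ac \<and> h \<in> range to_ac)" and one: "1 = to_ac p * g + to_ac q * h" "p \<noteq> 0" for g h :: "'b alg_closure" and p q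
  proof (rule basis)
    have gg: "g = to_ac (1 / p) + to_ac (- q / p) * h" using one by (simp add: field_simps)
    show "h \<notin> range to_ac"
    proof
      assume "h \<in> range to_ac"
      then obtain c where "h = to_ac c" by blast
      then have "g = to_ac (1 / p + - q / p * c)" "h = to_ac c" using gg by simp_all
      then show False using nb by blast
    qed
    show "\<exists>u v. z = to_ac u + to_ac v * h" for z
    proof -
      obtain u v where "z = to_ac u * g + to_ac v * h" using g by blast
      then have "z = to_ac (u / p) + to_ac (v - u * q / p) * h"
        unfolding gg by (simp add: algebra_simps)
      then show ?thesis by blast
    qed
  qed
  obtain p q where pq: "1 = to_ac p * e + to_ac q * f" using span by blast
  show thesis
  proof (cases "p = 0")
    case False
    show ?thesis by (rule exchange[OF span not_both pq False])
  next
    case True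
    then have "q \<noteq> 0" using pq by auto
    have swap: "\<exists>u v. z = to_ac u * f + to_ac v * e" for z using span[of z] by (metis add.commute)
    show ?thesis
      by (rule exchange[of f e q p]) (use swap not_both pq \<open>q \<noteq> 0\<close> in \<open>auto simp: add.commute\<close>)
  qed
qed

text \<open>
  With the basis \<open>{1, x}\<close> and \<open>x\<^sup>2 = c + b x\<close>, conjugation sends \<open>x\<close> to the other root \<open>b - x\<close> of
  its equation. It is the identity only if \<open>2 x = b\<close>, which forces characteristic \<open>2\<close> and
  \<open>b = 0\<close>. In that inseparable case squaring maps everything into the base field,
  since \<open>(u + v x)\<^sup>2 = u\<^sup>2 + v\<^sup>2 c\<close>; then \<open>x\<close> would have no square root.
\<close>

lemma real_closed_conjugation:
  assumes "real_closed TYPE('b::field)"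
  obtains \<sigma> :: "'b::field alg_closure \<Rightarrow> 'b alg_closure"
  where "field_involution \<sigma>" "\<sigma> \<noteq> id" "\<And>a. \<sigma> a = a \<Longrightarrow> a \<in> range to_ac"
proof -
  obtain x :: "'b alg_closure" where x: "x \<notin> range to_ac"
    and span: "\<And>z. \<exists>u v. z = to_ac u + to_ac v * x"
    using quadratic_basis_of_real_closed[OF assms] by blast
  have coord: "u = u' \<and> v = v'" if "to_ac u + to_ac v * x = to_ac u' + to_ac v' * x" for u v u' v'
  proof (rule ccontr)
    assume ne: "\<not> ?thesis"
    have eq: "to_ac (v - v') * x = to_ac (u' - u)" using that by (simp add: algebra_simps)
    show False
    proof (cases "v = v'")
      case True
      then show False using ne eq by simp
    next
      case False
      then have "x = to_ac ((u' - u) / (v - v'))" using eq by (simp add: field_simps)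
      then show False using x by blast
    qed
  qed
  obtain c b where xx: "x * x = to_ac c + to_ac b * x" using span by blast
  have "\<forall>z. \<exists>p. z = to_ac (fst p) + to_ac (snd p) * x"
    using span by (metis fst_conv snd_conv)
  then have "\<exists>p. \<forall>z. z = to_ac (fst (p z)) + to_ac (snd (p z)) * x" by (rule choice)
  then obtain p where p: "\<And>z. z = to_ac (fst (p z)) + to_ac (snd (p z)) * x" by blast
  define re im where "re z = fst (p z)" and "im z = snd (p z)" for z
  have dec: "z = to_ac (re z) + to_ac (im z) * x" for z unfolding re_def im_def by (rule p)
  define \<sigma> where "\<sigma> z = to_ac (re z) + to_ac (im z) * (to_ac b - x)" for z
  have \<sigma>: "\<sigma> (to_ac u + to_ac v * x) = to_ac u + to_ac v * (to_ac b - x)" for u v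
    using coord[OF dec[of "to_ac u + to_ac v * x"]] unfolding \<sigma>_def by simp
  have yy: "(to_ac b - x) * (to_ac b - x) = to_ac c + to_ac b * (to_ac b - x)"
    using xx by (simp add: algebra_simps)
  have add: "\<sigma> (z + w) = \<sigma> z + \<sigma> w" for z w
  proof -
    obtain u v where z: "z = to_ac u + to_ac v * x" using span by blast
    obtain u' v' where w: "w = to_ac u' + to_ac v' * x" using span by blast
    have "z + w = to_ac (u + u') + to_ac (v + v') * x" unfolding z w by (simp add: algebra_simps)
    then have "\<sigma> (z + w) = to_ac (u + u') + to_ac (v + v') * (to_ac b - x)" by (simp only: \<sigma>)
    then show ?thesis unfolding z w \<sigma> by (simp add: algebra_simps)
  qed
  have expand: "(to_ac u + to_ac v * y) * (to_ac u' + to_ac v' * y)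
      = to_ac (u * u' + v * v' * c) + to_ac (u * v' + v * u' + v * v' * b) * y"
    if "y * y = to_ac c + to_ac b * y" for y u v u' v'
  proof -
    have "(to_ac u + to_ac v * y) * (to_ac u' + to_ac v' * y)
        = to_ac u * to_ac u' + (to_ac u * to_ac v' + to_ac v * to_ac u') * y + to_ac v * to_ac v' * (y * y)"
      by (simp add: algebra_simps)
    then show ?thesis unfolding that by (simp add: algebra_simps)
  qed
  have mult: "\<sigma> (z * w) = \<sigma> z * \<sigma> w" for z w
  proof -
    obtain u v where z: "z = to_ac u + to_ac v * x" using span by blast
    obtain u' v' where w: "w = to_ac u' + to_ac v' * x" using span by blast
    show ?thesis unfolding z w expand[OF xx] \<sigma> expand[OF yy] ..
  qed
  have inv: "\<sigma> (\<sigma> z) = z" for z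
  proof -
    obtain u v where z: "z = to_ac u + to_ac v * x" using span by blast
    have "\<sigma> z = to_ac (u + v * b) + to_ac (- v) * x" unfolding z \<sigma> by (simp add: algebra_simps)
    then have "\<sigma> (\<sigma> z) = to_ac (u + v * b) + to_ac (- v) * (to_ac b - x)" by (simp only: \<sigma>)
    then show ?thesis unfolding z by (simp add: algebra_simps)
  qed
  have sx: "\<sigma> x = to_ac b - x" using \<sigma>[of 0 1] by simp
  have "\<sigma> x \<noteq> x"
  proof
    assume "\<sigma> x = x"
    then have 2: "to_ac 2 * x = to_ac b" using sx by (simp add: algebra_simps)
    have two: "(2::'b) = 0"
    proof (rule ccontr)
      assume "(2::'b) \<noteq> 0"
      then have "x = to_ac (b / 2)" using 2 by (simp add: field_simps del: to_ac_numeral)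
      then show False using x by blast
    qed
    then have b: "b = 0" using 2 by (simp del: to_ac_numeral)
    obtain y where "poly [:- x, 0, 1:] y = 0"
      using alg_closed_imp_poly_has_root[of "[:- x, 0, 1:]"] by auto
    then have y: "y * y = x" by simp
    obtain u v where "y = to_ac u + to_ac v * x" using span by blast
    then have "x = to_ac (u * u + v * v * c) + to_ac (u * v + v * u + v * v * b) * x"
      using y expand[OF xx] by metis
    moreover have "u * v + v * u + v * v * b = 2 * (u * v)" unfolding b by simp
    then have "u * v + v * u + v * v * b = 0" using two by simp
    ultimately have "x = to_ac (u * u + v * v * c)" by (simp only: to_ac_0 mult_zero_left add_0_right)
    then show False using x by blast
  qed
  show thesis
  proof (rule that)
    show "field_involution \<sigma>"
      unfolding field_involution_def
      using add mult inv by (auto simp: mult.commute intro!: o_bij[of \<sigma>])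
    show "\<sigma> \<noteq> id" using \<open>\<sigma> x \<noteq> x\<close> by auto
    show "a \<in> range to_ac" if "\<sigma> a = a" for a
    proof -
      obtain u v where a: "a = to_ac u + to_ac v * x" using span by blast
      have "to_ac v * (\<sigma> x - x) = 0" using that unfolding a \<sigma> sx by (simp add: algebra_simps)
      then have "v = 0" using \<open>\<sigma> x \<noteq> x\<close> by simp
      then show ?thesis unfolding a by simp
    qed
  qed
qed

section \<open>Polynomials in a square matrix\<close>

text \<open>
  Evaluation by the Horner scheme. The square matrices of a given size do not form a type, so
  \<open>poly\<close> does not apply; the size is taken from the number of rows of \<open>A\<close>.
\<close>

definition poly_mat :: "'a::comm_ring_1 poly \<Rightarrow> 'a mat \<Rightarrow> 'a mat" where
  "poly_mat p A = foldr (\<lambda>a M. a \<cdot>\<^sub>m 1\<^sub>m (dim_row A) + A * M) (coeffs p)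
    (0\<^sub>m (dim_row A) (dim_row A))"

context
  fixes n :: nat and A :: "'a::comm_ring_1 mat"
  assumes A: "A \<in> carrier_mat n n"
begin

lemma poly_mat_0: "poly_mat 0 A = 0\<^sub>m n n"
  using A by (simp add: poly_mat_def)

lemma poly_mat_pCons: "poly_mat (pCons a p) A = a \<cdot>\<^sub>m 1\<^sub>m n + A * poly_mat p A"
proof (cases "a = 0 \<and> p = 0")
  case True
  then show ?thesis using A poly_mat_0 by (auto intro!: eq_matI)
next
  case False
  then show ?thesis using A by (auto simp: poly_mat_def cCons_def)
qed

lemma poly_mat_carrier: "poly_mat p A \<in> carrier_mat n n"
  using A by (induction p) (auto simp: poly_mat_0 poly_mat_pCons)

lemma poly_mat_const: "poly_mat [:a:] A = a \<cdot>\<^sub>m 1\<^sub>m n"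
  using A by (simp add: poly_mat_pCons poly_mat_0)

lemma poly_mat_X: "poly_mat [:0, 1:] A = A"
proof -
  have "(1::'a) \<cdot>\<^sub>m 1\<^sub>m n = 1\<^sub>m n" "(0::'a) \<cdot>\<^sub>m 1\<^sub>m n = 0\<^sub>m n n" by (auto intro!: eq_matI)
  then show ?thesis using A by (simp add: poly_mat_pCons[of 0] poly_mat_const)
qed

lemma poly_mat_add: "poly_mat (p + q) A = poly_mat p A + poly_mat q A"
proof (induction p q rule: poly_induct2)
  case 0
  then show ?case by (simp add: poly_mat_0)
next
  case (pCons a p b q)
  have c: "A * poly_mat p A \<in> carrier_mat n n" "A * poly_mat q A \<in> carrier_mat n n"
    using A poly_mat_carrier[of p] poly_mat_carrier[of q] by simp_all
  have "poly_mat (pCons a p + pCons b q) A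
      = (a + b) \<cdot>\<^sub>m 1\<^sub>m n + (A * poly_mat p A + A * poly_mat q A)"
    using mult_add_distrib_mat[OF A poly_mat_carrier poly_mat_carrier]
    by (simp add: poly_mat_pCons pCons.IH)
  also have "\<dots> = (a \<cdot>\<^sub>m 1\<^sub>m n + A * poly_mat p A) + (b \<cdot>\<^sub>m 1\<^sub>m n + A * poly_mat q A)"
    using c A poly_mat_carrier[of p] poly_mat_carrier[of q]
    by (intro eq_matI) (auto simp: algebra_simps simp del: index_mult_mat(1))
  finally show ?case by (simp add: poly_mat_pCons)
qed

lemma poly_mat_smult: "poly_mat (smult c p) A = c \<cdot>\<^sub>m poly_mat p A"
proof (induction p)
  case 0
  then show ?case by (auto simp: poly_mat_0 intro!: eq_matI)
next
  case (pCons a p)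
  have c: "A * poly_mat p A \<in> carrier_mat n n"
    using A poly_mat_carrier[of p] by simp
  show ?case
    using c A poly_mat_carrier[of p] mult_smult_distrib[OF A poly_mat_carrier, of c p]
    by (simp add: poly_mat_pCons pCons.IH)
      (intro eq_matI, auto simp: algebra_simps simp del: index_mult_mat(1))
qed

lemma poly_mat_mult: "poly_mat (p * q) A = poly_mat p A * poly_mat q A"
proof (induction p)
  case 0
  then show ?case using poly_mat_carrier[of q] by (simp add: poly_mat_0)
next
  case (pCons a p)
  have Q: "poly_mat q A \<in> carrier_mat n n" and P: "poly_mat p A \<in> carrier_mat n n"
    by (rule poly_mat_carrier)+
  have "poly_mat (pCons a p * q) A = a \<cdot>\<^sub>m poly_mat q A + (0 \<cdot>\<^sub>m 1\<^sub>m n + A * (poly_mat p A * poly_mat q A))"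
    by (simp add: poly_mat_add poly_mat_smult poly_mat_pCons pCons.IH)
  also have "0 \<cdot>\<^sub>m 1\<^sub>m n + A * (poly_mat p A * poly_mat q A) = A * poly_mat p A * poly_mat q A"
    using A P Q by (intro eq_matI) (auto simp del: index_mult_mat(1))
  also have "a \<cdot>\<^sub>m poly_mat q A + \<dots> = (a \<cdot>\<^sub>m 1\<^sub>m n + A * poly_mat p A) * poly_mat q A"
    using A P Q mult_smult_assoc_mat[OF one_carrier_mat Q, of a]
    by (subst add_mult_distrib_mat[of _ n n _ _ n]) auto
  finally show ?case by (simp add: poly_mat_pCons)
qed

lemma poly_mat_commute: "poly_mat p A * poly_mat q A = poly_mat q A * poly_mat p A"
  unfolding poly_mat_mult[symmetric] by (simp only: mult.commute)

text \<open>
  Covers both the transport of polynomials along a similarity and the selfadjointness relation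
  \<open>M A = A\<^sup>* M\<close>.
\<close>

lemma poly_mat_intertwine:
  assumes B: "B \<in> carrier_mat n n" and M: "M \<in> carrier_mat n n" and MA: "M * A = B * M"
  shows "M * poly_mat p A = poly_mat p B * M"
proof -
  have pB0: "poly_mat 0 B = 0\<^sub>m n n" using B by (simp add: poly_mat_def)
  have pB: "poly_mat (pCons a p) B = a \<cdot>\<^sub>m 1\<^sub>m n + B * poly_mat p B \<and> poly_mat p B \<in> carrier_mat n n" for a p
  proof (induction p arbitrary: a)
    case 0
    show ?case using B by (cases "a = 0") (auto simp: poly_mat_def cCons_def intro!: eq_matI)
  next
    case (pCons b p)
    then show ?case using B by (auto simp: poly_mat_def cCons_def)
  qed
  show ?thesis
  proof (induction p)
    case 0
    then show ?case using M by (simp add: poly_mat_0 pB0)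
  next
    case (pCons a p)
    have P: "poly_mat p A \<in> carrier_mat n n" "poly_mat p B \<in> carrier_mat n n"
      using poly_mat_carrier pB by blast+
    have "M * poly_mat (pCons a p) A = M * (a \<cdot>\<^sub>m 1\<^sub>m n) + M * (A * poly_mat p A)"
      unfolding poly_mat_pCons using A M P by (intro mult_add_distrib_mat) auto
    also have "M * (A * poly_mat p A) = B * (M * poly_mat p A)"
      unfolding assoc_mult_mat[OF M A P(1), symmetric] MA by (rule assoc_mult_mat[OF B M P(1)])
    also have "\<dots> = B * poly_mat p B * M"
      unfolding pCons.IH by (rule assoc_mult_mat[OF B P(2) M, symmetric])
    also have "M * (a \<cdot>\<^sub>m 1\<^sub>m n) = (a \<cdot>\<^sub>m 1\<^sub>m n) * M"
      using M mult_smult_assoc_mat[OF one_carrier_mat M, of a] mult_smult_distrib[OF M one_carrier_mat, of a] by simp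
    also have "(a \<cdot>\<^sub>m 1\<^sub>m n) * M + B * poly_mat p B * M = poly_mat (pCons a p) B * M"
      using pB[of a p] B M P by (subst add_mult_distrib_mat[symmetric, of _ n n _ _ n]) auto
    finally show ?case .
  qed
qed

lemma poly_mat_transpose: "poly_mat p (transpose_mat A) = transpose_mat (poly_mat p A)"
proof (induction p)
  case 0
  then show ?case using A by (simp add: poly_mat_def)
next
  case (pCons a p)
  have P: "poly_mat p A \<in> carrier_mat n n" by (rule poly_mat_carrier)
  have "poly_mat (pCons a p) (transpose_mat A) = a \<cdot>\<^sub>m 1\<^sub>m n + transpose_mat A * transpose_mat (poly_mat p A)"
    using pCons.IH A P by (cases "a = 0 \<and> p = 0") (auto simp: poly_mat_def cCons_def intro!: eq_matI)
  also have "\<dots> = a \<cdot>\<^sub>m 1\<^sub>m n + transpose_mat (poly_mat p A * A)"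
    using A P by (simp add: transpose_mult)
  also have "poly_mat p A * A = A * poly_mat p A"
    using poly_mat_commute[of p "[:0, 1:]"] by (simp add: poly_mat_X)
  also have "a \<cdot>\<^sub>m 1\<^sub>m n + transpose_mat (A * poly_mat p A) = transpose_mat (poly_mat (pCons a p) A)"
    unfolding poly_mat_pCons using A P by (subst transpose_add[of _ n n]) (auto intro!: eq_matI simp del: index_mult_mat(1))
  finally show ?case .
qed

end

lemma (in comm_ring_hom) poly_mat_hom:
  assumes A: "A \<in> carrier_mat n n"
  shows "poly_mat (map_poly hom p) (mat\<^sub>h A) = mat\<^sub>h (poly_mat p A)"
proof -
  have hA: "mat\<^sub>h A \<in> carrier_mat n n" using A by simp
  show ?thesis
  proof (induction p)
    case 0
    have "mat\<^sub>h (0\<^sub>m n n) = 0\<^sub>m n n" by (intro eq_matI) auto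
    then show ?case by (simp add: poly_mat_0[OF A] poly_mat_0[OF hA])
  next
    case (pCons a p)
    have P: "poly_mat p A \<in> carrier_mat n n" by (rule poly_mat_carrier[OF A])
    have "poly_mat (map_poly hom (pCons a p)) (mat\<^sub>h A)
        = hom a \<cdot>\<^sub>m 1\<^sub>m n + mat\<^sub>h A * mat\<^sub>h (poly_mat p A)"
      using poly_mat_pCons[OF hA, of "hom a" "map_poly hom p"] pCons.IH
      by (simp only: Polynomial.map_poly_pCons[where f = hom, OF hom_zero])
    also have "\<dots> = hom a \<cdot>\<^sub>m 1\<^sub>m n + mat\<^sub>h (A * poly_mat p A)"
      unfolding mat_hom_mult[OF A P] ..
    also have "\<dots> = mat\<^sub>h (poly_mat (pCons a p) A)"
      unfolding poly_mat_pCons[OF A]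
      using A P by (intro eq_matI) (auto simp: hom_distribs simp del: index_mult_mat(1))
    finally show ?case .
  qed
qed

section \<open>Triangularisation and involutory matrices\<close>

lemma inverse_of_det_nonzero:
  fixes A :: "'a::field mat"
  assumes A: "A \<in> carrier_mat n n" and "det A \<noteq> 0"
  obtains B where "B \<in> carrier_mat n n" "A * B = 1\<^sub>m n" "B * A = 1\<^sub>m n"
  using det_non_zero_imp_unit[OF assms] unfolding Units_def ring_mat_def by auto

text \<open>
  Complete the eigenvector to a basis; it becomes the first column of the transition matrix.
\<close>

lemma eigenvector_deflation:
  fixes A :: "'a::field mat"
  assumes A: "A \<in> carrier_mat (Suc n) (Suc n)" and ev: "eigenvector A v k"
  obtains r B where "r \<in> carrier_mat 1 n" "B \<in> carrier_mat n n"
    "similar_mat A (four_block_mat (k \<cdot>\<^sub>m 1\<^sub>m 1) r (0\<^sub>m n 1) B)"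
proof -
  interpret vec_space "TYPE('a)" "Suc n" .
  have v: "v \<in> carrier_vec (Suc n)" "v \<noteq> 0\<^sub>v (Suc n)" and Av: "A *\<^sub>v v = k \<cdot>\<^sub>v v"
    using ev A unfolding eigenvector_def by auto
  define b where "b = basis_completion v"
  note b = basis_completion[OF v, folded b_def]
  define T where "T = mat_of_cols (Suc n) b"
  have T: "T \<in> carrier_mat (Suc n) (Suc n)" unfolding T_def using b(6) by (metis mat_of_cols_carrier(1))
  have cols: "cols T = b" unfolding T_def using b(2) by simp
  have "rank T = Suc n" using lin_indpt_full_rank[OF T] b(4,5) cols by simp
  then have "det T \<noteq> 0" using det_rank_iff[OF T] by simp
  then obtain S where S: "S \<in> carrier_mat (Suc n) (Suc n)" and TS: "T * S = 1\<^sub>m (Suc n)" "S * T = 1\<^sub>m (Suc n)"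
    using inverse_of_det_nonzero[OF T] by metis
  have T0: "col T 0 = v"
    using cols b(6,7) T by (metis carrier_matD(2) cols_length cols_nth hd_conv_nth list.size(3) nat.distinct(1) zero_less_Suc)
  define C where "C = S * A * T"
  have C: "C \<in> carrier_mat (Suc n) (Suc n)" unfolding C_def using S A T by simp
  have "A = T * C * S"
  proof -
    have "T * C * S = (T * S) * A * (T * S)"
      unfolding C_def using S A T by (simp add: assoc_mult_mat[of _ "Suc n" "Suc n" _ "Suc n" _ "Suc n"] mult_carrier_mat[of _ "Suc n" "Suc n" _ "Suc n"])
    then show ?thesis unfolding TS using A by simp
  qed
  then have sim: "similar_mat A C" using A C S T TS by (intro similar_matI[of _ _ T S "Suc n"]) auto
  have "col C 0 = (S * A) *\<^sub>v col T 0" unfolding C_def using S A T by (intro col_mult2) auto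
  also have "\<dots> = S *\<^sub>v (A *\<^sub>v v)" unfolding T0 using S A v by (intro assoc_mult_mat_vec) auto
  also have "\<dots> = k \<cdot>\<^sub>v (S *\<^sub>v col T 0)" unfolding Av T0 using S v by (intro mult_mat_vec) auto
  also have "S *\<^sub>v col T 0 = col (S * T) 0" using S T by (intro col_mult2[symmetric]) auto
  finally have C0: "col C 0 = k \<cdot>\<^sub>v col (1\<^sub>m (Suc n)) 0" unfolding TS .
  have entry: "C $$ (i, 0) = (if i = 0 then k else 0)" if "i < Suc n" for i
  proof -
    have "C $$ (i, 0) = col C 0 $ i" using C that by simp
    then show ?thesis unfolding C0 using that by auto
  qed
  obtain c r z B where spl: "split_block C 1 1 = (c, r, z, B)" by (metis prod_cases4)
  note sb = split_block[OF spl, of n n]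
  have dims: "dim_row C = 1 + n" "dim_col C = 1 + n" using C by auto
  have crzB: "c \<in> carrier_mat 1 1" "r \<in> carrier_mat 1 n" "z \<in> carrier_mat n 1" "B \<in> carrier_mat n n"
    "C = four_block_mat c r z B" using sb dims by auto
  have "c = k \<cdot>\<^sub>m 1\<^sub>m 1" using crzB entry[of 0] by (intro eq_matI) auto
  moreover have "z = 0\<^sub>m n 1"
  proof (rule eq_matI)
    fix i j assume "i < dim_row (0\<^sub>m n 1 :: 'a mat)" "j < dim_col (0\<^sub>m n 1 :: 'a mat)"
    then have ij: "i < n" "j = 0" by auto
    have "z $$ (i, j) = C $$ (Suc i, 0)" unfolding crzB(5) using crzB(1-4) ij by simp
    then show "z $$ (i, j) = 0\<^sub>m n 1 $$ (i, j)" using entry[of "Suc i"] ij by simp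
  qed (use crzB in auto)
  ultimately show thesis using that sim crzB by metis
qed

lemma poly_mat_block_triangular:
  fixes B :: "'a::comm_ring_1 mat"
  assumes c: "c \<in> carrier_mat 1 1" and r: "r \<in> carrier_mat 1 n" and B: "B \<in> carrier_mat n n"
  obtains d s where "d \<in> carrier_mat 1 1" "s \<in> carrier_mat 1 n"
    "poly_mat p (four_block_mat c r (0\<^sub>m n 1) B) = four_block_mat d s (0\<^sub>m n 1) (poly_mat p B)"
proof -
  let ?C = "four_block_mat c r (0\<^sub>m n 1) B"
  have C: "?C \<in> carrier_mat (Suc n) (Suc n)" 
    using four_block_carrier_mat[OF c B] by simp
  have "\<exists>d s. d \<in> carrier_mat 1 1 \<and> s \<in> carrier_mat 1 n \<and>
      poly_mat p ?C = four_block_mat d s (0\<^sub>m n 1) (poly_mat p B)"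
  proof (induction p)
    case 0
    have "four_block_mat (0\<^sub>m 1 1) (0\<^sub>m 1 n) (0\<^sub>m n 1) (0\<^sub>m n n) = (0\<^sub>m (Suc n) (Suc n) :: 'a mat)"
      by (intro eq_matI) auto
    then show ?case unfolding poly_mat_0[OF C] poly_mat_0[OF B] by (metis zero_carrier_mat)
  next
    case (pCons a p)
    then obtain d s where ds: "d \<in> carrier_mat 1 1" "s \<in> carrier_mat 1 n"
      "poly_mat p ?C = four_block_mat d s (0\<^sub>m n 1) (poly_mat p B)" by blast
    note P = poly_mat_carrier[OF B, of p]
    have one: "a \<cdot>\<^sub>m 1\<^sub>m (Suc n) = four_block_mat (a \<cdot>\<^sub>m 1\<^sub>m 1) (0\<^sub>m 1 n) (0\<^sub>m n 1) (a \<cdot>\<^sub>m 1\<^sub>m n)"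
      by (intro eq_matI) auto
    have "?C * poly_mat p ?C = four_block_mat (c * d + r * 0\<^sub>m n 1) (c * s + r * poly_mat p B)
        (0\<^sub>m n 1 * d + B * 0\<^sub>m n 1) (0\<^sub>m n 1 * s + B * poly_mat p B)"
      unfolding ds(3) by (rule mult_four_block_mat[OF c r zero_carrier_mat B ds(1,2) zero_carrier_mat P])
    also have "\<dots> = four_block_mat (c * d) (c * s + r * poly_mat p B) (0\<^sub>m n 1) (B * poly_mat p B)"
      using c r B ds(1,2) P by (intro cong_four_block_mat) simp_all
    finally have prod: "?C * poly_mat p ?C = \<dots>" .
    have "poly_mat (pCons a p) ?C
        = four_block_mat (a \<cdot>\<^sub>m 1\<^sub>m 1 + c * d) (0\<^sub>m 1 n + (c * s + r * poly_mat p B))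
          (0\<^sub>m n 1 + 0\<^sub>m n 1) (a \<cdot>\<^sub>m 1\<^sub>m n + B * poly_mat p B)"
      unfolding poly_mat_pCons[OF C] prod one
      using c r B ds(1,2) P by (intro add_four_block_mat) auto
    then show ?case unfolding poly_mat_pCons[OF B]
      using c r B ds(1,2) P by (intro exI conjI) auto
  qed
  then show thesis using that by blast
qed

text \<open>
  Deflation splits off a factor \<open>X - k\<close> at each step, because
  \<open>[0 r; 0 B - k] [d s; 0 0] = 0\<close>. The constants \<open>k\<close> are nonzero since their product is the
  determinant; this makes fourth roots of \<open>k\<^sup>2\<close> nonzero, as lifting requires.
\<close>

lemma annihilating_linear_factors:
  fixes A :: "'a::alg_closed_field mat"
  assumes "A \<in> carrier_mat n n" "det A \<noteq> 0"
  shows "\<exists>l. 0 \<notin> set l \<and> poly_mat (\<Prod>x\<leftarrow>l. [:- x, 1:]) A = 0\<^sub>m n n"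
  using assms
proof (induction n arbitrary: A)
  case 0
  then show ?case using poly_mat_carrier[OF 0(1), of 1] by (intro exI[of _ "[]"]) (auto intro!: eq_matI)
next
  case (Suc n)
  note A = Suc.prems(1)
  have "Polynomial.degree (char_poly A) = Suc n" using degree_monic_char_poly[OF A] by simp
  then obtain k where "poly (char_poly A) k = 0"
    using alg_closed_imp_poly_has_root[of "char_poly A"] by auto
  then obtain v where "eigenvector A v k"
    using eigenvalue_root_char_poly[OF A] unfolding eigenvalue_def by blast
  then obtain r B where r: "r \<in> carrier_mat 1 n" and B: "B \<in> carrier_mat n n"
    and sim: "similar_mat A (four_block_mat (k \<cdot>\<^sub>m 1\<^sub>m 1) r (0\<^sub>m n 1) B)"
    using eigenvector_deflation[OF A] by blast
  define C where "C = four_block_mat (k \<cdot>\<^sub>m 1\<^sub>m 1) r (0\<^sub>m n 1) B"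
  have C: "C \<in> carrier_mat (Suc n) (Suc n)" 
    unfolding C_def using four_block_carrier_mat[of "k \<cdot>\<^sub>m 1\<^sub>m 1" 1 1 B n n] B by simp
  have "det C = det (k \<cdot>\<^sub>m 1\<^sub>m 1 :: 'a mat) * det B"
    unfolding C_def by (rule det_four_block_mat_lower_left_zero_col) (use r B in auto)
  also have "\<dots> = k * det B" by simp
  finally have kB: "k \<noteq> 0" "det B \<noteq> 0"
    using det_similar[OF sim] Suc.prems(2) unfolding C_def by auto
  obtain l where l: "0 \<notin> set l" and lB: "poly_mat (\<Prod>x\<leftarrow>l. [:- x, 1:]) B = 0\<^sub>m n n"
    using Suc.IH[OF B kB(2)] by blast
  define M where "M = (\<Prod>x\<leftarrow>l. [:- x, 1:])"
  obtain d s where ds: "d \<in> carrier_mat 1 1" "s \<in> carrier_mat 1 n"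
    and MC: "poly_mat M C = four_block_mat d s (0\<^sub>m n 1) (poly_mat M B)"
    unfolding C_def by (rule poly_mat_block_triangular[of "k \<cdot>\<^sub>m 1\<^sub>m 1" r n B M]) (use r B in auto)
  have "poly_mat [:- k, 1:] C = (- k) \<cdot>\<^sub>m 1\<^sub>m (Suc n) + C * (1 \<cdot>\<^sub>m 1\<^sub>m (Suc n))"
    using poly_mat_pCons[OF C] poly_mat_const[OF C] by simp
  also have "C * (1 \<cdot>\<^sub>m 1\<^sub>m (Suc n)) = C"
    using C mult_smult_distrib[OF C one_carrier_mat, of 1] by (auto intro!: eq_matI)
  also have "(- k) \<cdot>\<^sub>m 1\<^sub>m (Suc n) + C = four_block_mat (0\<^sub>m 1 1) r (0\<^sub>m n 1) ((- k) \<cdot>\<^sub>m 1\<^sub>m n + B)"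
    unfolding C_def using r B by (intro eq_matI) auto
  finally have "poly_mat ([:- k, 1:] * M) C
      = four_block_mat (0\<^sub>m 1 1) r (0\<^sub>m n 1) ((- k) \<cdot>\<^sub>m 1\<^sub>m n + B) * four_block_mat d s (0\<^sub>m n 1) (0\<^sub>m n n)"
    unfolding poly_mat_mult[OF C] MC using lB unfolding M_def by simp
  also have "\<dots> = four_block_mat (0\<^sub>m 1 1 * d + r * 0\<^sub>m n 1) (0\<^sub>m 1 1 * s + r * 0\<^sub>m n n)
      (0\<^sub>m n 1 * d + ((- k) \<cdot>\<^sub>m 1\<^sub>m n + B) * 0\<^sub>m n 1) (0\<^sub>m n 1 * s + ((- k) \<cdot>\<^sub>m 1\<^sub>m n + B) * 0\<^sub>m n n)"
    by (rule mult_four_block_mat) (use r B ds in auto)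
  also have "\<dots> = four_block_mat (0\<^sub>m 1 1) (0\<^sub>m 1 n) (0\<^sub>m n 1) (0\<^sub>m n n)"
    using r B ds right_mult_zero_mat[of "(- k) \<cdot>\<^sub>m 1\<^sub>m n + B" n n]
    by (intro cong_four_block_mat) auto
  also have "\<dots> = 0\<^sub>m (Suc n) (Suc n)" by (intro eq_matI) auto
  finally have zero: "poly_mat ([:- k, 1:] * M) C = 0\<^sub>m (Suc n) (Suc n)" .
  obtain S T where ST: "similar_mat_wit A C S T" using sim unfolding C_def similar_mat_def by blast
  note w = similar_mat_witD2[OF A ST]
  have "A * S = S * C"
  proof -
    have "A * S = S * (C * (T * S))" unfolding w(3) using w(5-7)
      by (simp add: assoc_mult_mat[of _ "Suc n" "Suc n" _ "Suc n" _ "Suc n"] mult_carrier_mat[of _ "Suc n" "Suc n" _ "Suc n"])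
    then show ?thesis unfolding w(2) using C by simp
  qed
  then have "poly_mat ([:- k, 1:] * M) A * S = 0\<^sub>m (Suc n) (Suc n)"
    using poly_mat_intertwine[OF C A w(6), of "[:- k, 1:] * M"] right_mult_zero_mat[OF w(6)]
    unfolding zero by metis
  then have "poly_mat ([:- k, 1:] * M) A * S * T = 0\<^sub>m (Suc n) (Suc n)"
    using left_mult_zero_mat[OF w(7)] by metis
  then have "poly_mat ([:- k, 1:] * M) A = 0\<^sub>m (Suc n) (Suc n)"
    unfolding assoc_mult_mat[OF poly_mat_carrier[OF A] w(6,7)] w(1)
      right_mult_one_mat[OF poly_mat_carrier[OF A]] .
  then show ?case using l kB(1) unfolding M_def by (intro exI[of _ "k # l"]) simp
qed

lemma four_block_mat_inject:
  assumes "four_block_mat A B C D = four_block_mat A' B' C' D'"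
    and "A \<in> carrier_mat p q" "B \<in> carrier_mat p s" "C \<in> carrier_mat r q" "D \<in> carrier_mat r s"
    and "A' \<in> carrier_mat p q" "B' \<in> carrier_mat p s" "C' \<in> carrier_mat r q" "D' \<in> carrier_mat r s"
  shows "A = A' \<and> B = B' \<and> C = C' \<and> D = D'"
proof -
  define F where "F = four_block_mat A B C D"
  have eq: "F $$ (i, j) = four_block_mat A' B' C' D' $$ (i, j)" for i j unfolding F_def assms(1) ..
  have "A $$ (i, j) = A' $$ (i, j)" if "i < p" "j < q" for i j
    using eq[of i j] that assms(2-) unfolding F_def by simp
  moreover have "B $$ (i, j) = B' $$ (i, j)" if "i < p" "j < s" for i j
    using eq[of i "q + j"] that assms(2-) unfolding F_def by simp
  moreover have "C $$ (i, j) = C' $$ (i, j)" if "i < r" "j < q" for i j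
    using eq[of "p + i" j] that assms(2-) unfolding F_def by simp
  moreover have "D $$ (i, j) = D' $$ (i, j)" if "i < r" "j < s" for i j
    using eq[of "p + i" "q + j"] that assms(2-) unfolding F_def by simp
  ultimately show ?thesis using assms(2-) by (auto intro!: eq_matI)
qed

lemma sign_mat_carrier: "sign_mat p q \<in> carrier_mat (p + q) (p + q)"
  unfolding sign_mat_def by simp

lemma sign_mat_Suc: "four_block_mat (1\<^sub>m 1) (0\<^sub>m 1 (p + q)) (0\<^sub>m (p + q) 1) (sign_mat p q) = sign_mat (Suc p) q"
  unfolding sign_mat_def by (intro eq_matI) auto

text \<open>
  Unless \<open>D = -1\<close>, a nonzero column of \<open>D + 1\<close> is an eigenvector for \<open>1\<close>. Deflating it leaves
  \<open>[1 r; 0 B]\<close> with \<open>B\<^sup>2 = 1\<close> and \<open>r + r B = 0\<close>, and \<open>r\<close> can be conjugated away. Splitting off the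
  eigenvalue \<open>1\<close> first also yields the entries in the required order.
\<close>

lemma involutory_similar_sign_mat:
  fixes D :: "'a::field mat"
  assumes two: "(2::'a) \<noteq> 0" and "D \<in> carrier_mat n n" "D * D = 1\<^sub>m n"
  shows "\<exists>p\<le>n. similar_mat D (sign_mat p (n - p))"
  using assms(2-)
proof (induction n arbitrary: D)
  case 0
  then have "D = sign_mat 0 0" unfolding sign_mat_def by (intro eq_matI) auto
  then show ?case using similar_mat_refl[OF 0(1)] by auto
next
  case (Suc n)
  note D = Suc.prems(1)
  show ?case
  proof (cases "D = - 1\<^sub>m (Suc n)")
    case True
    then have "D = sign_mat 0 (Suc n)" unfolding sign_mat_def by (intro eq_matI) auto
    then show ?thesis using similar_mat_refl[OF D] by auto
  next
    case False
    define N where "N = D + 1\<^sub>m (Suc n)"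
    have N: "N \<in> carrier_mat (Suc n) (Suc n)" using D unfolding N_def by simp
    have "N \<noteq> 0\<^sub>m (Suc n) (Suc n)"
    proof
      assume N0: "N = 0\<^sub>m (Suc n) (Suc n)"
      have "D = - 1\<^sub>m (Suc n)"
      proof (rule eq_matI)
        fix i j assume ij: "i < dim_row (- 1\<^sub>m (Suc n) :: 'a mat)" "j < dim_col (- 1\<^sub>m (Suc n) :: 'a mat)"
        have "N $$ (i, j) = 0" unfolding N0 using ij by simp
        then show "D $$ (i, j) = (- 1\<^sub>m (Suc n)) $$ (i, j)"
          using ij D unfolding N_def by (auto simp: eq_neg_iff_add_eq_0)
      qed (use D in auto)
      then show False using False by simp
    qed
    then obtain i j where ij: "i < Suc n" "j < Suc n" "N $$ (i, j) \<noteq> 0"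
      using N by (metis carrier_matD eq_matI index_zero_mat)
    have DN: "D * N = N"
      unfolding N_def using D Suc.prems(2) mult_add_distrib_mat[OF D D one_carrier_mat]
      by (simp add: comm_add_mat[OF one_carrier_mat D])
    have "D *\<^sub>v col N j = col (D * N) j" using D N ij by (intro col_mult2[symmetric]) auto
    then have "D *\<^sub>v col N j = 1 \<cdot>\<^sub>v col N j" unfolding DN by simp
    moreover have "col N j \<noteq> 0\<^sub>v (Suc n)"
    proof
      assume "col N j = 0\<^sub>v (Suc n)"
      then have "col N j $ i = 0" using ij by simp
      then show False using ij N by simp
    qed
    ultimately have "eigenvector D (col N j) 1"
      unfolding eigenvector_def using D col_dim[of N j] N by auto
    then obtain r B where r: "r \<in> carrier_mat 1 n" and B: "B \<in> carrier_mat n n"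
      and sim: "similar_mat D (four_block_mat (1 \<cdot>\<^sub>m 1\<^sub>m 1) r (0\<^sub>m n 1) B)"
      using eigenvector_deflation[OF D] by blast
    have one: "1 \<cdot>\<^sub>m 1\<^sub>m 1 = (1\<^sub>m 1 :: 'a mat)" by (intro eq_matI) auto
    define C where "C = four_block_mat (1\<^sub>m 1) r (0\<^sub>m n 1) B"
    have C: "C \<in> carrier_mat (Suc n) (Suc n)"
      unfolding C_def using four_block_carrier_mat[of "1\<^sub>m 1" 1 1 B n n] B by simp
    obtain S T where ST: "similar_mat_wit C D S T"
      using similar_mat_sym[OF sim] unfolding one C_def similar_mat_def by blast
    note w = similar_mat_witD2[OF C ST]
    have "C * C = S * (D * (T * S) * D) * T" unfolding w(3) using w(5-7)
      by (simp add: assoc_mult_mat[of _ "Suc n" "Suc n" _ "Suc n" _ "Suc n"] mult_carrier_mat[of _ "Suc n" "Suc n" _ "Suc n"])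
    also have "\<dots> = 1\<^sub>m (Suc n)"
      unfolding w(2) right_mult_one_mat[OF D] Suc.prems(2) right_mult_one_mat[OF w(6)] w(1) ..
    finally have CC: "C * C = 1\<^sub>m (Suc n)" .
    have "C * C = four_block_mat (1\<^sub>m 1 * 1\<^sub>m 1 + r * 0\<^sub>m n 1) (1\<^sub>m 1 * r + r * B)
        (0\<^sub>m n 1 * 1\<^sub>m 1 + B * 0\<^sub>m n 1) (0\<^sub>m n 1 * r + B * B)"
      unfolding C_def by (rule mult_four_block_mat) (use r B in auto)
    also have "\<dots> = four_block_mat (1\<^sub>m 1) (r + r * B) (0\<^sub>m n 1) (B * B)"
      using r B by (intro cong_four_block_mat) auto
    finally have "four_block_mat (1\<^sub>m 1) (r + r * B) (0\<^sub>m n 1) (B * B)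
        = four_block_mat (1\<^sub>m 1) (0\<^sub>m 1 n) (0\<^sub>m n 1) (1\<^sub>m n)"
      unfolding CC by simp
    then have rB: "r + r * B = 0\<^sub>m 1 n" and BB: "B * B = 1\<^sub>m n"
      using four_block_mat_inject[of "1\<^sub>m 1" "r + r * B" "0\<^sub>m n 1" "B * B" "1\<^sub>m 1" "0\<^sub>m 1 n" "0\<^sub>m n 1" "1\<^sub>m n" 1 1 n n] r B
      by auto
    (* Conjugating by Q = [1 y; 0 1] turns r into y + r - y B, and r B = -r makes y = -r/2 work. *)
    define y where "y = (- 1 / 2) \<cdot>\<^sub>m r"
    have y: "y \<in> carrier_mat 1 n" unfolding y_def using r by simp
    have rB_neg: "r * B = - r"
    proof (rule eq_matI)
      fix i j assume "i < dim_row (- r)" "j < dim_col (- r)"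
      then have ij: "i < 1" "j < n" using r by auto
      have rBc: "r * B \<in> carrier_mat 1 n" using r B by simp
      have "(r + r * B) $$ (i, j) = 0" unfolding rB using ij by simp
      then show "(r * B) $$ (i, j) = (- r) $$ (i, j)"
        using index_add_mat(1)[of i "r * B" j r] ij rBc r B
        by (simp add: eq_neg_iff_add_eq_0 add.commute del: index_mult_mat(1))
    qed (use r B in auto)
    have yB: "y * B = y + r"
    proof -
      have "y * B = (- 1 / 2) \<cdot>\<^sub>m (r * B)" unfolding y_def by (rule mult_smult_assoc_mat[OF r B])
      also have "\<dots> = y + r"
        unfolding rB_neg y_def using r two by (intro eq_matI) (auto simp: field_simps)
      finally show ?thesis .
    qed
    define Q Q' E where "Q = four_block_mat (1\<^sub>m 1) y (0\<^sub>m n 1) (1\<^sub>m n)"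
      and "Q' = four_block_mat (1\<^sub>m 1) (- y) (0\<^sub>m n 1) (1\<^sub>m n)"
      and "E = four_block_mat (1\<^sub>m 1) (0\<^sub>m 1 n) (0\<^sub>m n 1) B"
    have QE: "Q \<in> carrier_mat (Suc n) (Suc n)" "Q' \<in> carrier_mat (Suc n) (Suc n)" "E \<in> carrier_mat (Suc n) (Suc n)"
      unfolding Q_def Q'_def E_def
      using four_block_carrier_mat[of "1\<^sub>m 1" 1 1 "1\<^sub>m n" n n] four_block_carrier_mat[of "1\<^sub>m 1" 1 1 B n n] B by simp_all
    have "Q * Q' = four_block_mat (1\<^sub>m 1 * 1\<^sub>m 1 + y * 0\<^sub>m n 1) (1\<^sub>m 1 * (- y) + y * 1\<^sub>m n)
        (0\<^sub>m n 1 * 1\<^sub>m 1 + 1\<^sub>m n * 0\<^sub>m n 1) (0\<^sub>m n 1 * (- y) + 1\<^sub>m n * 1\<^sub>m n)"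
      unfolding Q_def Q'_def by (rule mult_four_block_mat) (use y in auto)
    also have "\<dots> = four_block_mat (1\<^sub>m 1) (0\<^sub>m 1 n) (0\<^sub>m n 1) (1\<^sub>m n)"
    proof (rule cong_four_block_mat)
      show "1\<^sub>m 1 * (- y) + y * 1\<^sub>m n = 0\<^sub>m 1 n"
        using y uminus_carrier_iff_mat[of y 1 n] by (simp add: uminus_l_inv_mat)
    qed (use y in auto)
    finally have QQ: "Q * Q' = 1\<^sub>m (Suc n)" by simp
    have "C * Q = four_block_mat (1\<^sub>m 1 * 1\<^sub>m 1 + r * 0\<^sub>m n 1) (1\<^sub>m 1 * y + r * 1\<^sub>m n)
        (0\<^sub>m n 1 * 1\<^sub>m 1 + B * 0\<^sub>m n 1) (0\<^sub>m n 1 * y + B * 1\<^sub>m n)"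
      unfolding Q_def C_def by (rule mult_four_block_mat) (use y r B in auto)
    also have "\<dots> = four_block_mat (1\<^sub>m 1) (y + r) (0\<^sub>m n 1) B"
      using y r B by (intro cong_four_block_mat) auto
    finally have CQ: "C * Q = four_block_mat (1\<^sub>m 1) (y + r) (0\<^sub>m n 1) B" .
    have "Q * E = four_block_mat (1\<^sub>m 1 * 1\<^sub>m 1 + y * 0\<^sub>m n 1) (1\<^sub>m 1 * 0\<^sub>m 1 n + y * B)
        (0\<^sub>m n 1 * 1\<^sub>m 1 + 1\<^sub>m n * 0\<^sub>m n 1) (0\<^sub>m n 1 * 0\<^sub>m 1 n + 1\<^sub>m n * B)"
      unfolding Q_def E_def by (rule mult_four_block_mat) (use y B in auto)
    also have "\<dots> = four_block_mat (1\<^sub>m 1) (y * B) (0\<^sub>m n 1) B"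
      using y B by (intro cong_four_block_mat) auto
    finally have "Q * E = C * Q" unfolding CQ yB .
    then have "Q * E * Q' = C * (Q * Q')" using assoc_mult_mat[OF C QE(1,2)] by simp
    then have "C = Q * E * Q'" unfolding QQ using C by simp
    then have "similar_mat C E"
      using C QE QQ mat_mult_left_right_inverse[OF QE(1,2) QQ]
      by (intro similar_matI[of _ _ Q Q' "Suc n"]) auto
    then have DE: "similar_mat D E" using similar_mat_trans sim unfolding one C_def by blast
    obtain p where p: "p \<le> n" "similar_mat B (sign_mat p (n - p))" using Suc.IH[OF B BB] by blast
    have "similar_mat E (four_block_mat (1\<^sub>m 1) (0\<^sub>m 1 n) (0\<^sub>m n 1) (sign_mat p (n - p)))"
      unfolding E_def using similar_mat_four_block_0_0[OF similar_mat_refl[OF one_carrier_mat] p(2) one_carrier_mat B] .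
    then have "similar_mat E (sign_mat (Suc p) (n - p))" 
      unfolding sign_mat_Suc[of p "n - p", unfolded le_add_diff_inverse[OF p(1)]] .
    then show ?thesis using similar_mat_trans[OF DE] p(1) by (intro exI[of _ "Suc p"]) simp
  qed
qed

section \<open>From equivalence to congruence\<close>

lemma invertible_mat_iff_inverse:
  fixes A :: "'a::semiring_1 mat"
  assumes A: "A \<in> carrier_mat n n"
  shows "invertible_mat A \<longleftrightarrow> (\<exists>B\<in>carrier_mat n n. A * B = 1\<^sub>m n \<and> B * A = 1\<^sub>m n)"
proof
  assume "invertible_mat A"
  then obtain B where AB: "A * B = 1\<^sub>m n" "B * A = 1\<^sub>m (dim_row B)"
    using A unfolding invertible_mat_def inverts_mat_def by auto
  have "dim_col B = n" using arg_cong[OF AB(1), of dim_col] by simp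
  moreover have "dim_row B = n" using arg_cong[OF AB(2), of dim_col] A by simp
  ultimately show "\<exists>B\<in>carrier_mat n n. A * B = 1\<^sub>m n \<and> B * A = 1\<^sub>m n" using AB by auto
next
  assume "\<exists>B\<in>carrier_mat n n. A * B = 1\<^sub>m n \<and> B * A = 1\<^sub>m n"
  then show "invertible_mat A" using A unfolding invertible_mat_def inverts_mat_def by auto
qed

lemma invertible_mat_obtain_inverse:
  assumes "A \<in> carrier_mat n n" "invertible_mat A"
  obtains B where "B \<in> carrier_mat n n" "A * B = 1\<^sub>m n" "B * A = 1\<^sub>m n"
  using assms invertible_mat_iff_inverse by blast

lemma cancel_inverse_left:
  fixes A B C :: "'a::semiring_1 mat"
  assumes "A \<in> carrier_mat n n" "B \<in> carrier_mat n n" "C \<in> carrier_mat n n" "A * B = 1\<^sub>m n"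
  shows "A * (B * C) = C"
  using assoc_mult_mat[OF assms(1-3)] assms by simp

lemma invertible_mat_mult:
  fixes A B :: "'a::semiring_1 mat"
  assumes A: "A \<in> carrier_mat n n" and B: "B \<in> carrier_mat n n"
    and "invertible_mat A" "invertible_mat B"
  shows "invertible_mat (A * B)"
proof -
  obtain A' where A': "A' \<in> carrier_mat n n" "A * A' = 1\<^sub>m n" "A' * A = 1\<^sub>m n"
    using invertible_mat_obtain_inverse[OF A assms(3)] by blast
  obtain B' where B': "B' \<in> carrier_mat n n" "B * B' = 1\<^sub>m n" "B' * B = 1\<^sub>m n"
    using invertible_mat_obtain_inverse[OF B assms(4)] by blast
  have "A * B * (B' * A') = 1\<^sub>m n"
    using assoc_mult_mat[OF A B, of "B' * A'" n] cancel_inverse_left[OF B B'(1) A'(1) B'(2)] A' B' by simp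
  moreover have "B' * A' * (A * B) = 1\<^sub>m n"
    using assoc_mult_mat[OF B'(1) A'(1), of "A * B" n] cancel_inverse_left[OF A'(1) A B A'(3)] A B B' by simp
  moreover have "A * B \<in> carrier_mat n n" "B' * A' \<in> carrier_mat n n" using A B A' B' by simp_all
  ultimately show ?thesis using invertible_mat_iff_inverse by blast
qed

text \<open>
  Commuting with \<open>I\<^sub>p \<oplus> -I\<^sub>q\<close> means that the off-diagonal blocks equal their negatives.
\<close>

lemma block_diagonal_of_commute_sign_mat:
  fixes A :: "'a::field mat"
  assumes two: "(2::'a) \<noteq> 0" and A: "A \<in> carrier_mat (p + q) (p + q)"
    and comm: "sign_mat p q * A = A * sign_mat p q"
  shows "block_diagonal p q A"
proof -
  obtain B C D E where spl: "split_block A p p = (B, C, D, E)" by (metis prod_cases4)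
  have dims: "dim_row A = p + q" "dim_col A = p + q" using A by auto
  have B: "B \<in> carrier_mat p p" and C: "C \<in> carrier_mat p q" and D: "D \<in> carrier_mat q p"
    and E: "E \<in> carrier_mat q q" and blk: "A = four_block_mat B C D E"
    using split_block[OF spl dims] by simp_all
  have "sign_mat p q * A = four_block_mat (1\<^sub>m p * B + 0\<^sub>m p q * D) (1\<^sub>m p * C + 0\<^sub>m p q * E)
      (0\<^sub>m q p * B + (- 1\<^sub>m q) * D) (0\<^sub>m q p * C + (- 1\<^sub>m q) * E)"
    unfolding sign_mat_def blk by (rule mult_four_block_mat) (use B C D E in auto)
  also have "\<dots> = four_block_mat B C (- D) (- E)"
    using B C D E by (intro cong_four_block_mat) auto
  finally have 1: "sign_mat p q * A = four_block_mat B C (- D) (- E)" .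
  have "A * sign_mat p q = four_block_mat (B * 1\<^sub>m p + C * 0\<^sub>m q p) (B * 0\<^sub>m p q + C * (- 1\<^sub>m q))
      (D * 1\<^sub>m p + E * 0\<^sub>m q p) (D * 0\<^sub>m p q + E * (- 1\<^sub>m q))"
    unfolding sign_mat_def blk by (rule mult_four_block_mat) (use B C D E in auto)
  also have "\<dots> = four_block_mat B (- C) D (- E)"
    using B C D E by (intro cong_four_block_mat) auto
  finally have "four_block_mat B C (- D) (- E) = four_block_mat B (- C) D (- E)" using 1 comm by simp
  then have "B = B \<and> C = - C \<and> - D = D \<and> - E = - E"
    by (rule four_block_mat_inject[where p = p and q = p and r = q and s = q]) (use B C D E in auto)
  then have CC: "C = - C" and DD: "D = - D" by auto
  have half: "x = 0" if "x = - x" for x :: 'a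
  proof -
    have "2 * x = x + x" by (rule mult_2)
    also have "\<dots> = 0" using that by (metis add.right_inverse)
    finally show ?thesis using two by simp
  qed
  have "C = 0\<^sub>m p q"
  proof (rule eq_matI)
    fix i j assume "i < dim_row (0\<^sub>m p q :: 'a mat)" "j < dim_col (0\<^sub>m p q :: 'a mat)"
    then have ij: "i < p" "j < q" by auto
    have "C $$ (i, j) = (- C) $$ (i, j)" using CC by (rule arg_cong)
    also have "\<dots> = - C $$ (i, j)" using C ij by simp
    finally have "C $$ (i, j) = 0" by (rule half)
    then show "C $$ (i, j) = 0\<^sub>m p q $$ (i, j)" using ij by simp
  qed (use C in auto)
  moreover have "D = 0\<^sub>m q p"
  proof (rule eq_matI)
    fix i j assume "i < dim_row (0\<^sub>m q p :: 'a mat)" "j < dim_col (0\<^sub>m q p :: 'a mat)"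
    then have ij: "i < q" "j < p" by auto
    have "D $$ (i, j) = (- D) $$ (i, j)" using DD by (rule arg_cong)
    also have "\<dots> = - D $$ (i, j)" using D ij by simp
    finally have "D $$ (i, j) = 0" by (rule half)
    then show "D $$ (i, j) = 0\<^sub>m q p $$ (i, j)" using ij by simp
  qed (use D in auto)
  ultimately have "A = four_block_mat B (0\<^sub>m p q) (0\<^sub>m q p) E" using blk by simp
  then show ?thesis unfolding block_diagonal_def using B E by blast
qed

context
  fixes \<tau> :: "'a::field \<Rightarrow> 'a"
  assumes inv: "field_involution \<tau>"
begin

interpretation inj_comm_ring_hom \<tau> by (rule field_involution_hom[OF inv])

lemma star_mat_carrier: "A \<in> carrier_mat n m \<Longrightarrow> star_mat \<tau> A \<in> carrier_mat m n"
  unfolding star_mat_def by simp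

lemma star_mat_mult:
  assumes "A \<in> carrier_mat n k" "B \<in> carrier_mat k m"
  shows "star_mat \<tau> (A * B) = star_mat \<tau> B * star_mat \<tau> A"
  unfolding star_mat_def mat_hom_mult[OF assms] using assms by (simp add: transpose_mult[of _ n k _ m])

lemma star_mat_star_mat: "star_mat \<tau> (star_mat \<tau> A) = A"
  using inv unfolding star_mat_def field_involution_def by (auto intro!: eq_matI)

lemma star_mat_one: "star_mat \<tau> (1\<^sub>m n) = 1\<^sub>m n"
  unfolding star_mat_def by (simp add: mat_hom_one)

lemma star_mat_sign_mat: "star_mat \<tau> (sign_mat p q) = sign_mat p q"
  unfolding star_mat_def sign_mat_def by (auto simp: hom_distribs intro!: eq_matI)

lemma star_mat_invertible:
  assumes A: "A \<in> carrier_mat n n" and "invertible_mat A"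
  shows "invertible_mat (star_mat \<tau> A)"
proof -
  obtain B where B: "B \<in> carrier_mat n n" "A * B = 1\<^sub>m n" "B * A = 1\<^sub>m n"
    using invertible_mat_obtain_inverse[OF assms] by blast
  have "star_mat \<tau> A * star_mat \<tau> B = 1\<^sub>m n" "star_mat \<tau> B * star_mat \<tau> A = 1\<^sub>m n"
    unfolding star_mat_mult[OF B(1) A, symmetric] star_mat_mult[OF A B(1), symmetric] B star_mat_one
    by (rule refl)+
  then show ?thesis
    using invertible_mat_iff_inverse[OF star_mat_carrier[OF A]] star_mat_carrier[OF B(1)] by blast
qed

text \<open>
  Transposition reverses products, but powers of one matrix commute, so only the coefficients are
  changed.
\<close>

lemma star_mat_poly_mat:
  assumes A: "A \<in> carrier_mat n n"
  shows "poly_mat (map_poly \<tau> p) (star_mat \<tau> A) = star_mat \<tau> (poly_mat p A)"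
  using poly_mat_transpose[of "map_mat \<tau> A" n "map_poly \<tau> p"] poly_mat_hom[OF A, of p] A
  unfolding star_mat_def by simp

lemma star_congruence_comp:
  assumes S: "S \<in> carrier_mat n n" and T: "T \<in> carrier_mat n n" and A: "A \<in> carrier_mat n n"
  shows "T * (S * A * star_mat \<tau> S) * star_mat \<tau> T = (T * S) * A * star_mat \<tau> (T * S)"
  unfolding star_mat_mult[OF T S]
  using S T A star_mat_carrier[OF S] star_mat_carrier[OF T]
  by (simp add: assoc_mult_mat[of _ n n _ n _ n] mult_carrier_mat[of _ n n _ n])

lemma star_congruence_eps_hermitian:
  assumes S: "S \<in> carrier_mat n n" and A: "A \<in> carrier_mat n n" and "star_mat \<tau> A = e \<cdot>\<^sub>m A"
  shows "star_mat \<tau> (S * A * star_mat \<tau> S) = e \<cdot>\<^sub>m (S * A * star_mat \<tau> S)"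
proof -
  note S' = star_mat_carrier[OF S]
  have SA: "S * A \<in> carrier_mat n n" using S A by simp
  have "star_mat \<tau> (S * A * star_mat \<tau> S) = S * ((e \<cdot>\<^sub>m A) * star_mat \<tau> S)"
    unfolding star_mat_mult[OF SA S'] star_mat_star_mat star_mat_mult[OF S A] assms(3) ..
  also have "\<dots> = e \<cdot>\<^sub>m (S * (A * star_mat \<tau> S))"
    using mult_smult_assoc_mat[OF A S', of e] mult_smult_distrib[OF S, of "A * star_mat \<tau> S" n e] A S' by simp
  finally show ?thesis unfolding assoc_mult_mat[OF S A S'] .
qed

text \<open>
  With \<open>P = (S\<^sup>*)\<^sup>-\<^sup>1 R\<close> one has \<open>S A R = H P\<close> for \<open>H = S A S\<^sup>*\<close>. Both \<open>H\<close> and \<open>H P\<close> satisfy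
  \<open>M\<^sup>* = e M\<close>, so \<open>e H P = (H P)\<^sup>* = P\<^sup>* (e H)\<close>.
\<close>

lemma equivalence_reduction:
  assumes V: "V \<subseteq> carrier_mat n n" and W: "W \<subseteq> carrier_mat n n"
    and e: "e \<noteq> 0" and herm: "\<forall>A\<in>V \<union> W. star_mat \<tau> A = e \<cdot>\<^sub>m A"
    and equiv: "equivalent_spaces n V W"
  obtains S P where "S \<in> carrier_mat n n" "invertible_mat S" "P \<in> carrier_mat n n" "invertible_mat P"
    "W = (\<lambda>A. S * A * star_mat \<tau> S * P) ` V"
    "\<And>A. A \<in> V \<Longrightarrow> (S * A * star_mat \<tau> S) * P = star_mat \<tau> P * (S * A * star_mat \<tau> S)"
proof -
  obtain S R where S: "S \<in> carrier_mat n n" "invertible_mat S" and R: "R \<in> carrier_mat n n" "invertible_mat R"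
    and VW: "(\<lambda>A. S * A * R) ` V = W" using equiv unfolding equivalent_spaces_def by blast
  note S' = star_mat_carrier[OF S(1)]
  obtain Z where Z: "Z \<in> carrier_mat n n" "star_mat \<tau> S * Z = 1\<^sub>m n" "Z * star_mat \<tau> S = 1\<^sub>m n"
    using invertible_mat_obtain_inverse[OF S' star_mat_invertible[OF S]] by blast
  define P where "P = Z * R"
  have P: "P \<in> carrier_mat n n" unfolding P_def using Z R by simp
  have "invertible_mat Z" using Z S' invertible_mat_iff_inverse by blast
  then have iP: "invertible_mat P" unfolding P_def using invertible_mat_mult[OF Z(1) R(1) _ R(2)] by simp
  have SAP: "S * A * star_mat \<tau> S * P = S * A * R" if "A \<in> V" for A
  proof -
    have A: "S * A \<in> carrier_mat n n" using that V S by auto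
    have "S * A * star_mat \<tau> S * P = S * A * (star_mat \<tau> S * (Z * R))"
      unfolding P_def using assoc_mult_mat[OF A S' P[unfolded P_def]] .
    then show ?thesis using cancel_inverse_left[OF S' Z(1) R(1) Z(2)] by simp
  qed
  show thesis
  proof (rule that[OF S P iP])
    show "W = (\<lambda>A. S * A * star_mat \<tau> S * P) ` V" using VW SAP by (auto simp: image_iff)
    show "(S * A * star_mat \<tau> S) * P = star_mat \<tau> P * (S * A * star_mat \<tau> S)" if AV: "A \<in> V" for A
    proof -
      define H where "H = S * A * star_mat \<tau> S"
      have A: "A \<in> carrier_mat n n" using AV V by auto
      have H: "H \<in> carrier_mat n n" unfolding H_def using S A S' by simp
      have "star_mat \<tau> A = e \<cdot>\<^sub>m A" using herm AV by blast
      then have starH: "star_mat \<tau> H = e \<cdot>\<^sub>m H"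
        unfolding H_def by (rule star_congruence_eps_hermitian[OF S(1) A])
      have "H * P \<in> W" using AV VW SAP[OF AV] unfolding H_def by auto
      then have "e \<cdot>\<^sub>m (H * P) = star_mat \<tau> (H * P)" using herm by auto
      also have "\<dots> = star_mat \<tau> P * (e \<cdot>\<^sub>m H)"
        unfolding star_mat_mult[OF H P] starH ..
      also have "\<dots> = e \<cdot>\<^sub>m (star_mat \<tau> P * H)"
        by (rule mult_smult_distrib[OF star_mat_carrier[OF P] H])
      finally have "inverse e \<cdot>\<^sub>m (e \<cdot>\<^sub>m (H * P)) = inverse e \<cdot>\<^sub>m (e \<cdot>\<^sub>m (star_mat \<tau> P * H))" by simp
      moreover have "inverse e \<cdot>\<^sub>m (e \<cdot>\<^sub>m M) = M" for M :: "'a mat"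
        using e by (auto intro!: eq_matI simp: mult.assoc[symmetric])
      ultimately show ?thesis unfolding H_def by simp
    qed
  qed
qed

lemma selfadjoint_poly_mat:
  assumes A: "A \<in> carrier_mat n n" and P: "P \<in> carrier_mat n n"
    and AP: "A * P = star_mat \<tau> P * A" and g: "map_poly \<tau> g = g"
  shows "A * poly_mat g P = star_mat \<tau> (poly_mat g P) * A"
  using poly_mat_intertwine[OF P star_mat_carrier[OF P] A AP, of g] star_mat_poly_mat[OF P, of g] g by simp

text \<open>
  With \<open>P = G\<^sup>2\<close> and \<open>G\<close> a polynomial in \<open>P\<close>, \<open>H P = H G G = G\<^sup>* H G\<close>.
\<close>

lemma star_congruent_of_equivalent:
  assumes V: "V \<subseteq> carrier_mat n n" and W: "W \<subseteq> carrier_mat n n"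
    and e: "e \<noteq> 0" and herm: "\<forall>A\<in>V \<union> W. star_mat \<tau> A = e \<cdot>\<^sub>m A"
    and root: "\<And>P. P \<in> carrier_mat n n \<Longrightarrow> invertible_mat P \<Longrightarrow>
      \<exists>g. map_poly \<tau> g = g \<and> poly_mat g P * poly_mat g P = P"
    and equiv: "equivalent_spaces n V W"
  shows "star_congruent_spaces \<tau> n V W"
proof -
  obtain S P where S: "S \<in> carrier_mat n n" "invertible_mat S" and P: "P \<in> carrier_mat n n" "invertible_mat P"
    and VW: "W = (\<lambda>A. S * A * star_mat \<tau> S * P) ` V"
    and adj: "\<And>A. A \<in> V \<Longrightarrow> (S * A * star_mat \<tau> S) * P = star_mat \<tau> P * (S * A * star_mat \<tau> S)"
    using equivalence_reduction[OF V W e herm equiv] by blast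
  obtain g where g: "map_poly \<tau> g = g" "poly_mat g P * poly_mat g P = P" using root[OF P] by blast
  define G where "G = poly_mat g P"
  have G: "G \<in> carrier_mat n n" unfolding G_def by (rule poly_mat_carrier[OF P(1)])
  have GG: "G * G = P" using g(2) unfolding G_def .
  obtain Z where Z: "Z \<in> carrier_mat n n" "P * Z = 1\<^sub>m n" "Z * P = 1\<^sub>m n"
    using invertible_mat_obtain_inverse[OF P] by blast
  have GX: "G * (G * Z) = 1\<^sub>m n" using Z(2) GG assoc_mult_mat[OF G G Z(1)] by simp
  have GXc: "G * Z \<in> carrier_mat n n" using G Z by simp
  have iG: "invertible_mat G"
    using invertible_mat_iff_inverse[OF G] GX GXc mat_mult_left_right_inverse[OF G GXc GX] by blast
  note G' = star_mat_carrier[OF G]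
  have "S * A * star_mat \<tau> S * P = star_mat \<tau> G * S * A * star_mat \<tau> (star_mat \<tau> G * S)" if AV: "A \<in> V" for A
  proof -
    define H where "H = S * A * star_mat \<tau> S"
    have A: "A \<in> carrier_mat n n" using AV V by auto
    have H: "H \<in> carrier_mat n n" unfolding H_def using S A star_mat_carrier[OF S(1)] by simp
    have "H * P = H * G * G" using GG assoc_mult_mat[OF H G G] by simp
    also have "H * G = star_mat \<tau> G * H"
      unfolding G_def by (rule selfadjoint_poly_mat[OF H P(1) _ g(1)]) (use adj[OF AV] in \<open>simp add: H_def\<close>)
    also have "star_mat \<tau> G * H * G = star_mat \<tau> G * S * A * star_mat \<tau> (star_mat \<tau> G * S)"
      using star_congruence_comp[OF S(1) G' A] unfolding star_mat_star_mat H_def .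
    finally show ?thesis unfolding H_def .
  qed
  then have "(\<lambda>A. star_mat \<tau> G * S * A * star_mat \<tau> (star_mat \<tau> G * S)) ` V = W"
    unfolding VW by (intro image_cong) auto
  moreover have "star_mat \<tau> G * S \<in> carrier_mat n n" using G' S by simp
  moreover have "invertible_mat (star_mat \<tau> G * S)"
    by (rule invertible_mat_mult[OF G' S(1) star_mat_invertible[OF G iG] S(2)])
  ultimately show ?thesis unfolding star_congruent_spaces_def by blast
qed

text \<open>
  The matrix \<open>D = G\<^sup>2 P\<^sup>-\<^sup>1\<close> is the sign of \<open>P\<close>: it is an involution, and \<open>P\<close> is \<open>G\<^sup>2\<close> up to \<open>D\<close>.
\<close>

lemma signed_square_root:
  fixes G P Z D :: "'a mat"
  assumes G: "G \<in> carrier_mat n n" and P: "P \<in> carrier_mat n n"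
    and Z: "Z \<in> carrier_mat n n" "P * Z = 1\<^sub>m n" "Z * P = 1\<^sub>m n"
    and comm: "G * P = P * G" and G4: "(G * G) * (G * G) = P * P"
    and D_def: "D = G * G * Z"
  shows "D * D = 1\<^sub>m n" "G * D * G = P" "G * (G * (G * (G * (Z * Z)))) = 1\<^sub>m n"
    "Z * (G * G) = D"
proof -
  note simps = assoc_mult_mat[of _ n n _ n _ n] mult_carrier_mat[of _ n n _ n]
  have XG: "Z * G = G * Z"
  proof -
    have "Z * G = Z * (G * (P * Z))" unfolding Z(2) right_mult_one_mat[OF G] ..
    also have "\<dots> = Z * (G * P) * Z" using G P Z(1) by (simp add: simps)
    also have "\<dots> = Z * P * (G * Z)" unfolding comm using G P Z(1) by (simp add: simps)
    also have "\<dots> = G * Z" unfolding Z(3) using G Z(1) by simp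
    finally show ?thesis .
  qed
  have XGc: "Z * (G * M) = G * (Z * M)" if "M \<in> carrier_mat n n" for M
    using XG assoc_mult_mat[OF Z(1) G that] assoc_mult_mat[OF G Z(1) that] by simp
  have G4c: "G * (G * (G * (G * M))) = P * (P * M)" if "M \<in> carrier_mat n n" for M
  proof -
    have "G * (G * (G * (G * M))) = (G * G) * (G * G) * M" using G that by (simp add: simps)
    then show ?thesis unfolding G4 using P that by (simp add: simps)
  qed
  have c: "Z * M \<in> carrier_mat n n" "G * M \<in> carrier_mat n n" if "M \<in> carrier_mat n n" for M
    using Z G that by auto
  have PXX: "P * (P * (Z * Z)) = 1\<^sub>m n" using cancel_inverse_left[OF P Z(1) Z(1) Z(2)] Z(2) by simp
  show "Z * (G * G) = D" unfolding D_def XGc[OF G] XG using assoc_mult_mat[OF G G Z(1)] by simp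
  show "G * (G * (G * (G * (Z * Z)))) = 1\<^sub>m n" using G4c[of "Z * Z"] PXX Z by simp
  have "D * D = G * (G * (Z * (G * (G * Z))))"
    unfolding D_def using G Z(1) by (simp add: simps)
  also have "\<dots> = G * (G * (G * (G * (Z * Z))))" using G Z c by (simp add: XGc)
  also have "\<dots> = 1\<^sub>m n" using G4c[of "Z * Z"] PXX Z by simp
  finally show "D * D = 1\<^sub>m n" .
  have "G * D * G = G * (G * (G * (Z * G)))" unfolding D_def using G Z(1) by (simp add: simps)
  also have "\<dots> = P * (P * Z)" unfolding XG using G4c[OF Z(1)] .
  also have "\<dots> = P" unfolding Z(2) using P by simp
  finally show "G * D * G = P" .
qed

text \<open>
  The hypothesis \<open>root\<close> replaces the square root of \<open>P\<close> by a fourth root of \<open>P\<^sup>2\<close>, so \<open>P\<close> equals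
  \<open>G\<^sup>2\<close> only up to an involutory factor \<open>D\<close>. Since \<open>D\<close> is selfadjoint with respect to every form
  \<open>H = S A S\<^sup>*\<close>, its eigenspaces for \<open>1\<close> and \<open>-1\<close> are orthogonal for all these forms at once; a
  basis adapted to them block-diagonalises the whole space.
\<close>

lemma signed_congruence_of_equivalent:
  assumes two: "(2::'a) \<noteq> 0"
    and V: "V \<subseteq> carrier_mat n n" and W: "W \<subseteq> carrier_mat n n"
    and e: "e \<noteq> 0" and herm: "\<forall>A\<in>V \<union> W. star_mat \<tau> A = e \<cdot>\<^sub>m A"
    and root: "\<And>P. P \<in> carrier_mat n n \<Longrightarrow> invertible_mat P \<Longrightarrow>
      \<exists>g. map_poly \<tau> g = g \<and> (poly_mat g P * poly_mat g P) * (poly_mat g P * poly_mat g P) = P * P"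
    and equiv: "equivalent_spaces n V W"
  obtains p L where "p \<le> n" "L \<in> carrier_mat n n" "invertible_mat L"
    "\<And>A. A \<in> V \<Longrightarrow> block_diagonal p (n - p) (L * A * star_mat \<tau> L)"
    "star_congruent_spaces \<tau> n
      ((\<lambda>A. sign_mat p (n - p) * A) ` (\<lambda>A. L * A * star_mat \<tau> L) ` V) W"
proof -
  note simps = assoc_mult_mat[of _ n n _ n _ n] mult_carrier_mat[of _ n n _ n]
  obtain S P where S: "S \<in> carrier_mat n n" "invertible_mat S" and P: "P \<in> carrier_mat n n" "invertible_mat P"
    and VW: "W = (\<lambda>A. S * A * star_mat \<tau> S * P) ` V"
    and adj: "\<And>A. A \<in> V \<Longrightarrow> (S * A * star_mat \<tau> S) * P = star_mat \<tau> P * (S * A * star_mat \<tau> S)"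
    using equivalence_reduction[OF V W e herm equiv] by blast
  obtain g where g: "map_poly \<tau> g = g"
    "(poly_mat g P * poly_mat g P) * (poly_mat g P * poly_mat g P) = P * P" using root[OF P] by blast
  define G where "G = poly_mat g P"
  have G: "G \<in> carrier_mat n n" unfolding G_def by (rule poly_mat_carrier[OF P(1)])
  have comm: "G * P = P * G"
    using poly_mat_commute[OF P(1), of g "[:0, 1:]"] unfolding poly_mat_X[OF P(1)] G_def .
  obtain Z where Z: "Z \<in> carrier_mat n n" "P * Z = 1\<^sub>m n" "Z * P = 1\<^sub>m n"
    using invertible_mat_obtain_inverse[OF P] by blast
  define D where "D = G * G * Z"
  note sq = signed_square_root[OF G P(1) Z comm g(2)[folded G_def] D_def]
  have D: "D \<in> carrier_mat n n" unfolding D_def using G Z by simp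
  have iG: "invertible_mat G"
  proof -
    have c: "G * (G * (G * (Z * Z))) \<in> carrier_mat n n" using G Z by (simp add: simps)
    show ?thesis
      using invertible_mat_iff_inverse[OF G] sq(3) c mat_mult_left_right_inverse[OF G c sq(3)] by blast
  qed
  obtain p where p: "p \<le> n" "similar_mat D (sign_mat p (n - p))"
    using involutory_similar_sign_mat[OF two D sq(1)] by blast
  define J :: "'a mat" where "J = sign_mat p (n - p)"
  have J: "J \<in> carrier_mat n n" unfolding J_def using sign_mat_carrier[of p "n - p"] p(1) by simp
  obtain T Y where TY: "similar_mat_wit D J T Y" using p(2) unfolding J_def similar_mat_def by blast
  note w = similar_mat_witD2[OF D TY]
  note T = w(6) and Y = w(7)
  have iT: "invertible_mat T" and iY: "invertible_mat Y"
    using invertible_mat_iff_inverse T Y w(1,2) by blast+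
  have TJ: "T * J = D * T"
  proof -
    have "D * T = T * J * (Y * T)" unfolding w(3) using T Y J by (simp add: simps)
    then show ?thesis unfolding w(2) using T J by simp
  qed
  note S' = star_mat_carrier[OF S(1)] and G' = star_mat_carrier[OF G] and T' = star_mat_carrier[OF T]
    and Y' = star_mat_carrier[OF Y] and P' = star_mat_carrier[OF P(1)] and Z' = star_mat_carrier[OF Z(1)]
    and D' = star_mat_carrier[OF D]
  define L where "L = star_mat \<tau> T * S"
  define M where "M = star_mat \<tau> G * star_mat \<tau> Y"
  have L: "L \<in> carrier_mat n n" unfolding L_def using T' S by simp
  have M: "M \<in> carrier_mat n n" unfolding M_def using G' Y' by simp
  have iL: "invertible_mat L" unfolding L_def
    by (rule invertible_mat_mult[OF T' S(1) star_mat_invertible[OF T iT] S(2)])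
  have iM: "invertible_mat M" unfolding M_def
    by (rule invertible_mat_mult[OF G' Y' star_mat_invertible[OF G iG] star_mat_invertible[OF Y iY]])
  have starM: "star_mat \<tau> M = Y * G"
    unfolding M_def using star_mat_mult[OF G' Y'] by (simp add: star_mat_star_mat)
  have TY1: "star_mat \<tau> Y * star_mat \<tau> T = 1\<^sub>m n"
    using star_mat_mult[OF T Y] w(1) star_mat_one by simp
  have main: "J * (L * A * star_mat \<tau> L) = (L * A * star_mat \<tau> L) * J
      \<and> M * (J * (L * A * star_mat \<tau> L)) * star_mat \<tau> M = S * A * star_mat \<tau> S * P" if AV: "A \<in> V" for A
  proof -
    define H where "H = S * A * star_mat \<tau> S"
    have A: "A \<in> carrier_mat n n" using AV V by auto
    have H: "H \<in> carrier_mat n n" unfolding H_def using S A S' by simp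
    have HP: "H * P = star_mat \<tau> P * H" using adj[OF AV] unfolding H_def .
    have HG: "H * G = star_mat \<tau> G * H"
      unfolding G_def by (rule selfadjoint_poly_mat[OF H P(1) HP g(1)])
    have HX: "H * Z = star_mat \<tau> Z * H"
    proof -
      have "star_mat \<tau> Z * star_mat \<tau> P = 1\<^sub>m n"
        using star_mat_mult[OF P(1) Z(1)] Z(2) star_mat_one by simp
      then have "H * Z = star_mat \<tau> Z * (star_mat \<tau> P * (H * Z))"
        using cancel_inverse_left[OF Z' P', of "H * Z"] H Z by simp
      also have "\<dots> = star_mat \<tau> Z * ((star_mat \<tau> P * H) * Z)" using P' H Z by (simp add: simps)
      also have "\<dots> = star_mat \<tau> Z * (H * (P * Z))" unfolding HP[symmetric] using P H Z by (simp add: simps)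
      finally show ?thesis unfolding Z(2) using H by simp
    qed
    (* D is selfadjoint for H, being a product of commuting selfadjoint factors. *)
    have HD: "H * D = star_mat \<tau> D * H"
    proof -
      have GGc: "G * G \<in> carrier_mat n n" using G by simp
      have "star_mat \<tau> D * H = star_mat \<tau> Z * (star_mat \<tau> G * (star_mat \<tau> G * H))"
        unfolding D_def star_mat_mult[OF GGc Z(1)] star_mat_mult[OF G G] using G' Z' H by (simp add: simps)
      also have "star_mat \<tau> G * (star_mat \<tau> G * H) = (star_mat \<tau> G * H) * G"
        unfolding HG[symmetric] assoc_mult_mat[OF G' H G, symmetric] ..
      also have "\<dots> = H * G * G" unfolding HG ..
      also have "star_mat \<tau> Z * (H * G * G) = (star_mat \<tau> Z * H) * (G * G)" using Z' H G by (simp add: simps)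
      also have "\<dots> = H * (Z * (G * G))" unfolding HX[symmetric] using Z H G by (simp add: simps)
      also have "Z * (G * G) = D" by (rule sq(4))
      finally show ?thesis by simp
    qed
    define B where "B = star_mat \<tau> T * H * T"
    have B: "B \<in> carrier_mat n n" unfolding B_def using T' H T by simp
    have LAL: "L * A * star_mat \<tau> L = B"
      using star_congruence_comp[OF S(1) T' A] unfolding star_mat_star_mat L_def B_def H_def by simp
    have JB: "J * B = B * J"
    proof -
      have "B * J = star_mat \<tau> T * (H * (T * J))" unfolding B_def using T' H T J by (simp add: simps)
      also have "\<dots> = star_mat \<tau> T * (H * D * T)" unfolding TJ using T' H T D by (simp add: simps)
      also have "\<dots> = star_mat \<tau> T * star_mat \<tau> D * (H * T)" unfolding HD using T' H T D' by (simp add: simps)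
      also have "star_mat \<tau> T * star_mat \<tau> D = star_mat \<tau> J * star_mat \<tau> T"
        unfolding star_mat_mult[OF D T, symmetric] TJ[symmetric] by (rule star_mat_mult[OF T J])
      also have "star_mat \<tau> J = J" unfolding J_def by (rule star_mat_sign_mat)
      finally show ?thesis unfolding B_def using T' H T J by (simp add: simps)
    qed
    have "M * (J * B) * star_mat \<tau> M = M * (star_mat \<tau> T * (H * (T * J))) * (Y * G)"
      unfolding JB starM unfolding B_def using T' H T J by (simp add: simps)
    also have "\<dots> = star_mat \<tau> G * (star_mat \<tau> Y * (star_mat \<tau> T * (H * (T * (J * (Y * G))))))"
      unfolding M_def using T' H T J Y G G' Y' by (simp add: simps)
    also have "\<dots> = star_mat \<tau> G * (H * (T * (J * (Y * G))))"
      using cancel_inverse_left[OF Y' T' _ TY1, of "H * (T * (J * (Y * G)))"] H T J Y G by (simp add: simps)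
    also have "T * (J * (Y * G)) = D * G" unfolding w(3) using T J Y G by (simp add: simps)
    also have "star_mat \<tau> G * (H * (D * G)) = (star_mat \<tau> G * H) * (D * G)" using G' H D G by (simp add: simps)
    also have "\<dots> = H * (G * D * G)" unfolding HG[symmetric] using H D G by (simp add: simps)
    also have "\<dots> = H * P" unfolding sq(2) ..
    finally show ?thesis unfolding LAL using JB unfolding H_def by simp
  qed
  show thesis
  proof (rule that[OF p(1) L iL])
    show "block_diagonal p (n - p) (L * A * star_mat \<tau> L)" if "A \<in> V" for A
    proof -
      have "L * A * star_mat \<tau> L \<in> carrier_mat n n" using L that V star_mat_carrier[OF L] by auto
      then show ?thesis
        using block_diagonal_of_commute_sign_mat[OF two, of "L * A * star_mat \<tau> L" p "n - p"]
          main[OF that] p(1) unfolding J_def by simp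
    qed
    have "(\<lambda>A. M * A * star_mat \<tau> M) ` (\<lambda>A. J * A) ` (\<lambda>A. L * A * star_mat \<tau> L) ` V = W"
      unfolding VW image_image by (rule image_cong[OF refl conjunct2[OF main]])
    then show "star_congruent_spaces \<tau> n
      ((\<lambda>A. sign_mat p (n - p) * A) ` (\<lambda>A. L * A * star_mat \<tau> L) ` V) W"
      unfolding star_congruent_spaces_def J_def using M iM by blast
  qed
qed

end

section \<open>Equivalence of spaces of matrices\<close>

lemma sign_mat_squared: "sign_mat p q * sign_mat p q = 1\<^sub>m (p + q)"
proof -
  have "sign_mat p q * sign_mat p q = four_block_mat
      (1\<^sub>m p * 1\<^sub>m p + 0\<^sub>m p q * 0\<^sub>m q p) (1\<^sub>m p * 0\<^sub>m p q + 0\<^sub>m p q * (- 1\<^sub>m q))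
      (0\<^sub>m q p * 1\<^sub>m p + (- 1\<^sub>m q) * 0\<^sub>m q p) (0\<^sub>m q p * 0\<^sub>m p q + (- 1\<^sub>m q) * (- 1\<^sub>m q))"
    unfolding sign_mat_def by (rule mult_four_block_mat) auto
  also have "\<dots> = four_block_mat (1\<^sub>m p) (0\<^sub>m p q) (0\<^sub>m q p) (1\<^sub>m q)"
    by (intro cong_four_block_mat) auto
  finally show ?thesis by simp
qed

lemma invertible_sign_mat: "invertible_mat (sign_mat p q)"
  using invertible_mat_iff_inverse[OF sign_mat_carrier] sign_mat_carrier sign_mat_squared by blast

lemma det_nonzero_of_invertible:
  fixes A :: "'a::field mat"
  assumes A: "A \<in> carrier_mat n n" and "invertible_mat A"
  shows "det A \<noteq> 0"
proof -
  obtain B where B: "B \<in> carrier_mat n n" "A * B = 1\<^sub>m n"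
    using invertible_mat_obtain_inverse[OF assms] by blast
  have "det A * det B = 1" using det_mult[OF A B(1)] B(2) by simp
  then show ?thesis by auto
qed

lemma mat_space_over_UNIV_carrier: "mat_space n V \<Longrightarrow> V \<subseteq> carrier_mat n n"
  using mat_space_over_iff[of UNIV id n V] by simp

context
  fixes \<tau> :: "'a::field \<Rightarrow> 'a"
  assumes inv: "field_involution \<tau>"
begin

lemma mat_space_star_congruence:
  assumes K: "K = UNIV \<or> K = {a. \<tau> a = a}" and L: "L \<in> carrier_mat n n"
    and V: "mat_space_over K n V"
  shows "mat_space_over K n ((\<lambda>A. L * A * star_mat \<tau> L) ` V)"
proof -
  have K': "K = UNIV \<or> field_involution \<tau> \<and> K = {a. \<tau> a = a}" using K inv by blast
  note L' = star_mat_carrier[OF inv L]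
  have Vc: "V \<subseteq> carrier_mat n n" and V0: "0\<^sub>m n n \<in> V"
    and Vadd: "\<And>A B. A \<in> V \<Longrightarrow> B \<in> V \<Longrightarrow> A + B \<in> V"
    and Vsm: "\<And>c A. c \<in> K \<Longrightarrow> A \<in> V \<Longrightarrow> c \<cdot>\<^sub>m A \<in> V"
    using V unfolding mat_space_over_iff[OF K'] by auto
  have zero: "L * 0\<^sub>m n n * star_mat \<tau> L = 0\<^sub>m n n" using L L' by simp
  have add: "L * A * star_mat \<tau> L + L * B * star_mat \<tau> L = L * (A + B) * star_mat \<tau> L"
    if "A \<in> V" "B \<in> V" for A B
  proof -
    have AB: "A \<in> carrier_mat n n" "B \<in> carrier_mat n n" using that Vc by auto
    have "L * A \<in> carrier_mat n n" "L * B \<in> carrier_mat n n" using L AB by simp_all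
    then show ?thesis
      unfolding mult_add_distrib_mat[OF L AB] using L' by (intro add_mult_distrib_mat[symmetric])
  qed
  have smult: "c \<cdot>\<^sub>m (L * A * star_mat \<tau> L) = L * (c \<cdot>\<^sub>m A) * star_mat \<tau> L" if "A \<in> V" for c A
  proof -
    have A: "A \<in> carrier_mat n n" using that Vc by auto
    have LA: "L * A \<in> carrier_mat n n" using L A by simp
    show ?thesis unfolding mult_smult_distrib[OF L A] mult_smult_assoc_mat[OF LA L'] ..
  qed
  show ?thesis
    unfolding mat_space_over_iff[OF K']
  proof (intro conjI ballI)
    show "(\<lambda>A. L * A * star_mat \<tau> L) ` V \<subseteq> carrier_mat n n" using Vc L L' by auto
    show "0\<^sub>m n n \<in> (\<lambda>A. L * A * star_mat \<tau> L) ` V" using zero V0 by (metis image_eqI)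
    show "A + B \<in> (\<lambda>A. L * A * star_mat \<tau> L) ` V"
      if "A \<in> (\<lambda>A. L * A * star_mat \<tau> L) ` V" "B \<in> (\<lambda>A. L * A * star_mat \<tau> L) ` V" for A B
      using that add Vadd by auto
    show "c \<cdot>\<^sub>m A \<in> (\<lambda>A. L * A * star_mat \<tau> L) ` V"
      if "c \<in> K" "A \<in> (\<lambda>A. L * A * star_mat \<tau> L) ` V" for c A
      using that smult Vsm by auto
  qed
qed

lemma equivalent_of_star_congruent:
  assumes "star_congruent_spaces \<tau> n V W"
  shows "equivalent_spaces n V W"
  using assms star_mat_carrier[OF inv] star_mat_invertible[OF inv]
  unfolding star_congruent_spaces_def equivalent_spaces_def by blast

lemma equivalent_of_signed_star_congruent:
  assumes V: "V \<subseteq> carrier_mat n n" and p: "p \<le> n"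
    and VU: "star_congruent_spaces \<tau> n V U"
    and UW: "star_congruent_spaces \<tau> n ((\<lambda>A. sign_mat p (n - p) * A) ` U) W"
  shows "equivalent_spaces n V W"
proof -
  note simps = assoc_mult_mat[of _ n n _ n _ n] mult_carrier_mat[of _ n n _ n]
  define J :: "'a mat" where "J = sign_mat p (n - p)"
  have J: "J \<in> carrier_mat n n" unfolding J_def using sign_mat_carrier[of p "n - p"] p by simp
  obtain S where S: "S \<in> carrier_mat n n" "invertible_mat S" and U: "(\<lambda>A. S * A * star_mat \<tau> S) ` V = U"
    using VU unfolding star_congruent_spaces_def by blast
  obtain T where T: "T \<in> carrier_mat n n" "invertible_mat T"
    and W: "(\<lambda>A. T * A * star_mat \<tau> T) ` (\<lambda>A. J * A) ` U = W"
    using UW unfolding star_congruent_spaces_def J_def by blast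
  note S' = star_mat_carrier[OF inv S(1)] and T' = star_mat_carrier[OF inv T(1)]
  have "T * (J * (S * A * star_mat \<tau> S)) * star_mat \<tau> T = (T * J * S) * A * (star_mat \<tau> S * star_mat \<tau> T)"
    if "A \<in> V" for A
  proof -
    have "A \<in> carrier_mat n n" using that V by auto
    then show ?thesis using S T S' T' J by (simp add: simps)
  qed
  then have "(\<lambda>A. (T * J * S) * A * (star_mat \<tau> S * star_mat \<tau> T)) ` V = W"
    unfolding W[symmetric] U[symmetric] image_image by (intro image_cong refl) simp
  moreover have TJ: "T * J \<in> carrier_mat n n" using T J by simp
  moreover have "invertible_mat (T * J * S)"
    using invertible_mat_mult[OF TJ S(1) invertible_mat_mult[OF T(1) J T(2)] S(2)]
      invertible_sign_mat unfolding J_def by blast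
  moreover have "invertible_mat (star_mat \<tau> S * star_mat \<tau> T)"
    by (rule invertible_mat_mult[OF S' T' star_mat_invertible[OF inv S] star_mat_invertible[OF inv T]])
  moreover have "T * J * S \<in> carrier_mat n n" "star_mat \<tau> S * star_mat \<tau> T \<in> carrier_mat n n"
    using TJ S S' T' by simp_all
  ultimately show ?thesis unfolding equivalent_spaces_def by blast
qed

lemma signed_star_congruent_of_equivalent:
  assumes two: "(2::'a) \<noteq> 0" and K: "K = UNIV \<or> K = {a. \<tau> a = a}"
    and V: "mat_space_over K n V" and W: "mat_space_over K n W"
    and e: "e \<noteq> 0" and herm: "\<forall>A\<in>V \<union> W. star_mat \<tau> A = e \<cdot>\<^sub>m A"
    and root: "\<And>P. P \<in> carrier_mat n n \<Longrightarrow> invertible_mat P \<Longrightarrow>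
      \<exists>g. map_poly \<tau> g = g \<and> (poly_mat g P * poly_mat g P) * (poly_mat g P * poly_mat g P) = P * P"
    and equiv: "equivalent_spaces n V W"
  shows "\<exists>p\<le>n. \<exists>U. mat_space_over K n U \<and>
    (\<forall>A\<in>U. block_diagonal p (n - p) A \<and> star_mat \<tau> A = e \<cdot>\<^sub>m A) \<and>
    star_congruent_spaces \<tau> n V U \<and>
    star_congruent_spaces \<tau> n ((\<lambda>A. sign_mat p (n - p) * A) ` U) W"
proof -
  have K': "K = UNIV \<or> field_involution \<tau> \<and> K = {a. \<tau> a = a}" using K inv by blast
  have Vc: "V \<subseteq> carrier_mat n n" and Wc: "W \<subseteq> carrier_mat n n"
    using V W unfolding mat_space_over_iff[OF K'] by auto
  obtain p L where p: "p \<le> n" and L: "L \<in> carrier_mat n n" "invertible_mat L"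
    and diag: "\<And>A. A \<in> V \<Longrightarrow> block_diagonal p (n - p) (L * A * star_mat \<tau> L)"
    and UW: "star_congruent_spaces \<tau> n
      ((\<lambda>A. sign_mat p (n - p) * A) ` (\<lambda>A. L * A * star_mat \<tau> L) ` V) W"
    using signed_congruence_of_equivalent[OF inv two Vc Wc e herm root equiv] by blast
  define U where "U = (\<lambda>A. L * A * star_mat \<tau> L) ` V"
  have "mat_space_over K n U" unfolding U_def by (rule mat_space_star_congruence[OF K L(1) V])
  moreover have "star_congruent_spaces \<tau> n V U"
    unfolding star_congruent_spaces_def U_def using L by blast
  moreover have "block_diagonal p (n - p) A \<and> star_mat \<tau> A = e \<cdot>\<^sub>m A" if AU: "A \<in> U" for A
  proof -
    obtain B where B: "B \<in> V" "A = L * B * star_mat \<tau> L" using AU unfolding U_def by blast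
    then have "star_mat \<tau> B = e \<cdot>\<^sub>m B" "B \<in> carrier_mat n n" using herm Vc by auto
    then show ?thesis
      using diag[OF B(1)] star_congruence_eps_hermitian[OF inv L(1), of B e] unfolding B(2) by blast
  qed
  ultimately show ?thesis using p UW unfolding U_def by blast
qed

end

section \<open>Polynomial roots of nonsingular matrices\<close>

lemma poly_mat_eq_of_dvd:
  assumes A: "A \<in> carrier_mat n n" and M: "poly_mat M A = 0\<^sub>m n n" and dvd: "M dvd p - q"
  shows "poly_mat p A = poly_mat q A"
proof -
  obtain h where h: "p - q = M * h" using dvd by (auto elim: dvdE)
  then have "p = q + M * h" by (simp add: algebra_simps)
  then show ?thesis
    using poly_mat_carrier[OF A, of q] left_mult_zero_mat[OF poly_mat_carrier[OF A, of h]]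
    by (simp add: poly_mat_add[OF A] poly_mat_mult[OF A] M)
qed

text \<open>
  Any choice of square roots of the eigenvalues lifts to a polynomial square root.
\<close>

lemma matrix_square_root:
  fixes P :: "'a::alg_closed_field mat"
  assumes two: "(2::'a) \<noteq> 0" and P: "P \<in> carrier_mat n n" "invertible_mat P"
  shows "\<exists>g. poly_mat g P * poly_mat g P = P"
proof -
  obtain l where l: "0 \<notin> set l" and ann: "poly_mat (\<Prod>x\<leftarrow>l. [:- x, 1:]) P = 0\<^sub>m n n"
    using annihilating_linear_factors[OF P(1) det_nonzero_of_invertible[OF P]] by blast
  have "\<exists>s. s ^ 2 = x" for x :: 'a
  proof -
    obtain s where "poly [:- x, 0, 1:] s = 0"
      using alg_closed_imp_poly_has_root[of "[:- x, 0, 1:]"] by auto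
    then show ?thesis by (auto simp: power2_eq_square)
  qed
  then obtain c where c: "\<And>x::'a. c x ^ 2 = x" by metis
  have c0: "c x \<noteq> 0" if "x \<in> set l" for x using c[of x] that l by auto
  obtain g where g: "(\<Prod>x\<leftarrow>l. [:- x, 1:]) dvd g ^ 2 - [:0, 1:]"
    using root_lifting[of 2 l c "[:0, 1:]"] two c c0 by auto
  have "poly_mat (g * g) P = P"
    using poly_mat_eq_of_dvd[OF P(1) ann g] unfolding poly_mat_X[OF P(1)] power2_eq_square .
  then show ?thesis unfolding poly_mat_mult[OF P(1)] by blast
qed

lemma invariant_matrix_fourth_root:
  fixes P :: "'a::alg_closed_field mat"
  assumes inv: "field_involution \<sigma>" "\<sigma> \<noteq> id" and P: "P \<in> carrier_mat n n" "invertible_mat P"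
  shows "\<exists>g. map_poly \<sigma> g = g \<and>
    (poly_mat g P * poly_mat g P) * (poly_mat g P * poly_mat g P) = P * P"
proof -
  obtain l where l: "0 \<notin> set l" and ann: "poly_mat (\<Prod>x\<leftarrow>l. [:- x, 1:]) P = 0\<^sub>m n n"
    using annihilating_linear_factors[OF P(1) det_nonzero_of_invertible[OF P]] by blast
  obtain g where g: "map_poly \<sigma> g = g" "(\<Prod>x\<leftarrow>l. [:- x, 1:]) dvd g ^ 4 - [:0, 1:] ^ 2"
    using invariant_poly_fourth_root[OF inv l] by blast
  have g4: "g ^ 4 = (g * g) * (g * g)" by (simp add: power4_eq_xxxx mult.assoc)
  have "poly_mat ((g * g) * (g * g)) P = poly_mat ([:0, 1:] * [:0, 1:]) P"
    using poly_mat_eq_of_dvd[OF P(1) ann g(2)] unfolding g4 power2_eq_square .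
  then show ?thesis using g(1) unfolding poly_mat_mult[OF P(1)] poly_mat_X[OF P(1)] by blast
qed

lemma real_closed_two_nonzero:
  assumes "real_closed TYPE('b::field)"
  shows "(2::'b) \<noteq> 0"
proof -
  obtain \<sigma> :: "'b alg_closure \<Rightarrow> 'b alg_closure" where "field_involution \<sigma>" "\<sigma> \<noteq> id"
    using real_closed_conjugation[OF assms] by blast
  then have "(2 :: 'b alg_closure) \<noteq> 0" by (rule two_nonzero_of_involution)
  then show ?thesis by (metis to_ac_0 to_ac_numeral)
qed

text \<open>
  Pass to the algebraic closure, where conjugation is an involution whose fixed elements are those
  of the base field: an invariant polynomial descends.
\<close>

lemma real_closed_matrix_fourth_root:
  fixes P :: "'b::field mat"
  assumes rc: "real_closed TYPE('b)" and P: "P \<in> carrier_mat n n" "invertible_mat P"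
  shows "\<exists>g. (poly_mat g P * poly_mat g P) * (poly_mat g P * poly_mat g P) = P * P"
proof -
  obtain \<sigma> :: "'b alg_closure \<Rightarrow> 'b alg_closure"
    where inv: "field_involution \<sigma>" "\<sigma> \<noteq> id" and fixed: "\<And>a. \<sigma> a = a \<Longrightarrow> a \<in> range to_ac"
    using real_closed_conjugation[OF rc] by blast
  interpret h: inj_comm_ring_hom "to_ac :: 'b \<Rightarrow> _"
    by unfold_locales auto
  define Q where "Q = map_mat to_ac P"
  have Q: "Q \<in> carrier_mat n n" unfolding Q_def using P(1) by simp
  obtain R where R: "R \<in> carrier_mat n n" "P * R = 1\<^sub>m n" "R * P = 1\<^sub>m n"
    using invertible_mat_obtain_inverse[OF P] by blast
  have "Q * map_mat to_ac R = 1\<^sub>m n" "map_mat to_ac R * Q = 1\<^sub>m n"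
    unfolding Q_def h.mat_hom_mult[OF P(1) R(1), symmetric] h.mat_hom_mult[OF R(1) P(1), symmetric]
      R(2,3) h.mat_hom_one by (rule refl)+
  then have "invertible_mat Q"
    using invertible_mat_iff_inverse[OF Q] R(1) map_carrier_mat by blast
  then obtain f where f: "map_poly \<sigma> f = f"
    and f4: "(poly_mat f Q * poly_mat f Q) * (poly_mat f Q * poly_mat f Q) = Q * Q"
    using invariant_matrix_fourth_root[OF inv Q] by blast
  define g where "g = map_poly of_ac f"
  have \<sigma>0: "\<sigma> 0 = 0" using inv(1)
    by (metis add_cancel_left_left field_involution_def)
  have of0: "of_ac (0 :: 'b alg_closure) = 0" by (rule of_ac_eqI) simp
  have "f = map_poly to_ac g"
  proof (rule poly_eqI)
    fix i
    have "\<sigma> (Polynomial.coeff f i) = Polynomial.coeff f i"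
      using arg_cong[OF f, of "\<lambda>p. Polynomial.coeff p i"] \<sigma>0 by (simp add: Polynomial.coeff_map_poly)
    then show "Polynomial.coeff f i = Polynomial.coeff (map_poly to_ac g) i"
      unfolding g_def using fixed of0 by (simp add: Polynomial.coeff_map_poly to_ac_of_ac)
  qed
  then have fg: "poly_mat f Q = map_mat to_ac (poly_mat g P)"
    unfolding Q_def using h.poly_mat_hom[OF P(1)] by simp
  have G: "poly_mat g P \<in> carrier_mat n n" by (rule poly_mat_carrier[OF P(1)])
  have GG: "poly_mat g P * poly_mat g P \<in> carrier_mat n n" using G by simp
  have "map_mat to_ac ((poly_mat g P * poly_mat g P) * (poly_mat g P * poly_mat g P)) = map_mat to_ac (P * P)"
    using f4 unfolding fg unfolding Q_def h.mat_hom_mult[OF G G] h.mat_hom_mult[OF GG GG] h.mat_hom_mult[OF P(1) P(1)] .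
  then have "(poly_mat g P * poly_mat g P) * (poly_mat g P * poly_mat g P) = P * P"
    by (rule h.mat_hom_inj)
  then show ?thesis by blast
qed

section \<open>The equivalence criteria\<close>

lemma star_mat_id: "star_mat id = transpose_mat"
  unfolding star_mat_def by (auto intro!: ext eq_matI)

lemma congruent_spaces_eq_star: "congruent_spaces n = star_congruent_spaces id n"
  unfolding congruent_spaces_def star_congruent_spaces_def star_mat_id by (intro ext) simp

text \<open>
  The two cases merge into \<open>e = 1\<close> and \<open>e = -1\<close>.
\<close>

lemma eps_symmetric:
  fixes M :: "'a::field mat set"
  assumes "(\<forall>A\<in>M. symmetric_mat A) \<or> (\<forall>A\<in>M. skew_symmetric_mat A)"
  obtains e :: 'a where "e \<noteq> 0" "\<forall>A\<in>M. star_mat id A = e \<cdot>\<^sub>m A"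
  using assms
proof
  assume "\<forall>A\<in>M. symmetric_mat A"
  then have "\<forall>A\<in>M. star_mat id A = 1 \<cdot>\<^sub>m A"
    unfolding star_mat_id symmetric_mat_def by (auto intro!: eq_matI)
  then show thesis using that[of 1] by simp
next
  assume "\<forall>A\<in>M. skew_symmetric_mat A"
  then have "\<forall>A\<in>M. star_mat id A = (- 1) \<cdot>\<^sub>m A"
    unfolding star_mat_id skew_symmetric_mat_def by (auto intro!: eq_matI)
  then show thesis using that[of "- 1"] by simp
qed

lemma two_nonzero_of_char:
  assumes "CHAR('a::field) \<noteq> 2"
  shows "(2::'a) \<noteq> 0"
proof
  assume "(2::'a) = 0"
  then have "of_nat 2 = (0::'a)" by simp
  then have dvd: "CHAR('a) dvd 2" by (simp only: of_nat_eq_0_iff_char_dvd)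
  then have "CHAR('a) \<le> 2" by (rule dvd_imp_le) simp
  moreover have "CHAR('a) \<noteq> 0" using dvd by (metis dvd_0_left zero_neq_numeral)
  moreover have "CHAR('a) \<noteq> 1" by simp
  ultimately show False using assms by linarith
qed

theorem corollary2:
  fixes n :: nat
    and Va Wa :: "'a::alg_closed_field mat set"
    and Vb Wb :: "'b::field mat set"
    and Vc Wc :: "'c::alg_closed_field mat set"
    and \<sigma> :: "'c \<Rightarrow> 'c"
    and K :: "'c set"
  shows
    "(CHAR('a) \<noteq> 2 \<and> mat_space n Va \<and> mat_space n Wa \<and>
      ((\<forall>A\<in>Va \<union> Wa. symmetric_mat A) \<or> (\<forall>A\<in>Va \<union> Wa. skew_symmetric_mat A))
      \<longrightarrow> (equivalent_spaces n Va Wa \<longleftrightarrow> congruent_spaces n Va Wa))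
   \<and> (real_closed TYPE('b) \<and> mat_space n Vb \<and> mat_space n Wb \<and>
      ((\<forall>A\<in>Vb \<union> Wb. symmetric_mat A) \<or> (\<forall>A\<in>Vb \<union> Wb. skew_symmetric_mat A))
      \<longrightarrow> (equivalent_spaces n Vb Wb \<longleftrightarrow>
           (\<exists>p\<le>n. \<exists>U. mat_space n U \<and> (\<forall>A\<in>U. block_diagonal p (n - p) A) \<and>
              congruent_spaces n Vb U \<and>
              congruent_spaces n ((\<lambda>A. sign_mat p (n - p) * A) ` U) Wb)))
   \<and> (field_involution \<sigma> \<and> \<sigma> \<noteq> id \<and> K \<in> hermitian_scalars \<sigma> \<and>
      mat_space_over K n Vc \<and> mat_space_over K n Wc \<and>
      (\<forall>A\<in>Vc \<union> Wc. hermitian_mat \<sigma> A)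
      \<longrightarrow> (equivalent_spaces n Vc Wc \<longleftrightarrow>
           (\<exists>p\<le>n. \<exists>U. mat_space_over K n U \<and>
              (\<forall>A\<in>U. block_diagonal p (n - p) A \<and> hermitian_mat \<sigma> A) \<and>
              star_congruent_spaces \<sigma> n Vc U \<and>
              star_congruent_spaces \<sigma> n ((\<lambda>A. sign_mat p (n - p) * A) ` U) Wc)))"
proof (intro conjI impI)
  assume asm: "CHAR('a) \<noteq> 2 \<and> mat_space n Va \<and> mat_space n Wa \<and>
      ((\<forall>A\<in>Va \<union> Wa. symmetric_mat A) \<or> (\<forall>A\<in>Va \<union> Wa. skew_symmetric_mat A))"
  then have "(\<forall>A\<in>Va \<union> Wa. symmetric_mat A) \<or> (\<forall>A\<in>Va \<union> Wa. skew_symmetric_mat A)" by blast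
  then obtain e where e: "e \<noteq> 0" and herm: "\<forall>A\<in>Va \<union> Wa. star_mat id A = e \<cdot>\<^sub>m A" by (rule eps_symmetric)
  have two: "(2::'a) \<noteq> 0" using asm two_nonzero_of_char by blast
  have V: "Va \<subseteq> carrier_mat n n" and W: "Wa \<subseteq> carrier_mat n n"
    using asm mat_space_over_UNIV_carrier by blast+
  have root: "\<exists>g. map_poly id g = g \<and> poly_mat g P * poly_mat g P = P"
    if "P \<in> carrier_mat n n" "invertible_mat P" for P :: "'a mat"
    using matrix_square_root[OF two that] by (auto simp: map_poly_id)
  show "equivalent_spaces n Va Wa \<longleftrightarrow> congruent_spaces n Va Wa"
    unfolding congruent_spaces_eq_star
    using star_congruent_of_equivalent[OF field_involution_id V W e herm root]
      equivalent_of_star_congruent[OF field_involution_id] by blast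
next
  assume asm: "real_closed TYPE('b) \<and> mat_space n Vb \<and> mat_space n Wb \<and>
      ((\<forall>A\<in>Vb \<union> Wb. symmetric_mat A) \<or> (\<forall>A\<in>Vb \<union> Wb. skew_symmetric_mat A))"
  then have "(\<forall>A\<in>Vb \<union> Wb. symmetric_mat A) \<or> (\<forall>A\<in>Vb \<union> Wb. skew_symmetric_mat A)" by blast
  then obtain e where e: "e \<noteq> 0" and herm: "\<forall>A\<in>Vb \<union> Wb. star_mat id A = e \<cdot>\<^sub>m A" by (rule eps_symmetric)
  have rc: "real_closed TYPE('b)" and sp: "mat_space n Vb" "mat_space n Wb" using asm by blast+
  have V: "Vb \<subseteq> carrier_mat n n" by (rule mat_space_over_UNIV_carrier[OF sp(1)])
  have root: "\<exists>g. map_poly id g = g \<and>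
      (poly_mat g P * poly_mat g P) * (poly_mat g P * poly_mat g P) = P * P"
    if "P \<in> carrier_mat n n" "invertible_mat P" for P :: "'b mat"
    using real_closed_matrix_fourth_root[OF rc that] by (auto simp: map_poly_id)
  show "equivalent_spaces n Vb Wb \<longleftrightarrow>
      (\<exists>p\<le>n. \<exists>U. mat_space n U \<and> (\<forall>A\<in>U. block_diagonal p (n - p) A) \<and>
        congruent_spaces n Vb U \<and>
        congruent_spaces n ((\<lambda>A. sign_mat p (n - p) * A) ` U) Wb)"
    unfolding congruent_spaces_eq_star
    using signed_star_congruent_of_equivalent[OF field_involution_id real_closed_two_nonzero[OF rc] disjI1[OF refl] sp e herm root]
      equivalent_of_signed_star_congruent[OF field_involution_id V] by blast
next
  assume asm: "field_involution \<sigma> \<and> \<sigma> \<noteq> id \<and> K \<in> hermitian_scalars \<sigma> \<and>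
      mat_space_over K n Vc \<and> mat_space_over K n Wc \<and> (\<forall>A\<in>Vc \<union> Wc. hermitian_mat \<sigma> A)"
  then have inv: "field_involution \<sigma>" "\<sigma> \<noteq> id" and sp: "mat_space_over K n Vc" "mat_space_over K n Wc"
    and K: "K = UNIV \<or> K = {a. \<sigma> a = a}"
    unfolding hermitian_scalars_def by blast+
  have herm_iff: "hermitian_mat \<sigma> A \<longleftrightarrow> star_mat \<sigma> A = 1 \<cdot>\<^sub>m A" for A
  proof -
    have "1 \<cdot>\<^sub>m A = A" by (auto intro!: eq_matI)
    then show ?thesis unfolding hermitian_mat_def by simp
  qed
  have herm: "\<forall>A\<in>Vc \<union> Wc. star_mat \<sigma> A = 1 \<cdot>\<^sub>m A" using asm herm_iff by blast
  have V: "Vc \<subseteq> carrier_mat n n" using sp K inv(1) mat_space_over_iff[of K \<sigma> n Vc] by blast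
  show "equivalent_spaces n Vc Wc \<longleftrightarrow>
      (\<exists>p\<le>n. \<exists>U. mat_space_over K n U \<and>
        (\<forall>A\<in>U. block_diagonal p (n - p) A \<and> hermitian_mat \<sigma> A) \<and>
        star_congruent_spaces \<sigma> n Vc U \<and>
        star_congruent_spaces \<sigma> n ((\<lambda>A. sign_mat p (n - p) * A) ` U) Wc)"
    unfolding herm_iff
    using signed_star_congruent_of_equivalent[OF inv(1) two_nonzero_of_involution[OF inv] K sp one_neq_zero herm invariant_matrix_fourth_root[OF inv]]
      equivalent_of_signed_star_congruent[OF inv(1) V] by blast
qed

end
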